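(* Let $G = \langle x, y, t \mid x^y = x^2,\ x^t = y\rangle$ be the Baumslag-Gersten group, let $H = \langle x, y\rangle \le G$, and let $F : G \to G$ be a group homomorphism. (1) If $F(x) = 1$, then $F(y) = 1$, and $F(t)$ can be any element (that is, for every $w \in G$ there is a homomorphism $G \to G$ with $x \mapsto 1$, $y \mapsto 1$, $t \mapsto w$). (2) If $F(x) \neq 1$, then $F$ is an automorphism of $G$, and there exist an inner automorphism $A$ of $G$ and an element $g \in C_H(x)$ such that $(A \circ F)(x) = x$, $(A\circ F)(y) = y$ and $(A \circ F)(t) = g t$.
   Context: Notation: $a^b = b^{-1} a b$. $G$ is an HNN extension, with stable letter $t$, of the Baumslag-Solitar group presented by $\langle x, y \mid x^y = x^2 \rangle$; this group embeds in $G$ as the subgroup $\langle x,y\rangle$ generated by $x$ and $y$, and is identified with it and denoted $H$. $C_H(x) = \{h \in H : hx = xh\}$ is the centralizer of $x$ in $H$. *)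

theory Defs
  imports "HOL-Algebra.Algebra"
begin

section \<open>Groups given by generators and relations\<close>

text \<open>A letter \<open>(a, True)\<close> stands for the generator \<open>a\<close> and \<open>(a, False)\<close> for its
  formal inverse. The generators of a presentation are all elements of the type \<open>'g\<close>;
  a relation \<open>u = v\<close> is the pair \<open>(u, v)\<close> of words.\<close>

type_synonym 'g word = "('g \<times> bool) list"

inductive_set pres_rel :: "('g word \<times> 'g word) set \<Rightarrow> ('g word \<times> 'g word) set"
  for R :: "('g word \<times> 'g word) set" where
  refl: "(u, u) \<in> pres_rel R"
| sym: "(u, v) \<in> pres_rel R \<Longrightarrow> (v, u) \<in> pres_rel R"
| trans: "(u, v) \<in> pres_rel R \<Longrightarrow> (v, w) \<in> pres_rel R \<Longrightarrow> (u, w) \<in> pres_rel R"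
| cancel: "(u @ [(a, b), (a, \<not> b)] @ v, u @ v) \<in> pres_rel R"
| relation: "(l, r) \<in> R \<Longrightarrow> (u @ l @ v, u @ r @ v) \<in> pres_rel R"

definition word_class :: "('g word \<times> 'g word) set \<Rightarrow> 'g word \<Rightarrow> 'g word set" where
  "word_class R w = pres_rel R `` {w}"

definition presented_group :: "('g word \<times> 'g word) set \<Rightarrow> 'g word set monoid" where
  "presented_group R =
    \<lparr>carrier = UNIV // pres_rel R,
     monoid.mult = (\<lambda>A B. \<Union>u\<in>A. \<Union>v\<in>B. word_class R (u @ v)),
     one = word_class R []\<rparr>"

lemma equiv_pres_rel: "equiv UNIV (pres_rel R)"
proof (rule equivI)
  show "refl_on UNIV (pres_rel R)" by (simp add: refl_on_def pres_rel.refl)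
  show "sym (pres_rel R)" by (rule symI) (rule pres_rel.sym)
  show "trans (pres_rel R)" by (rule transI) (rule pres_rel.trans)
qed simp

lemma word_class_eq_iff: "word_class R u = word_class R v \<longleftrightarrow> (u, v) \<in> pres_rel R"
  unfolding word_class_def by (rule eq_equiv_class_iff[OF equiv_pres_rel]) auto

lemma pres_rel_append_left:
  "(u, v) \<in> pres_rel R \<Longrightarrow> (w @ u, w @ v) \<in> pres_rel R"
proof (induction rule: pres_rel.induct)
  case (cancel u a b v)
  show ?case using pres_rel.cancel[of "w @ u" a b v R] by simp
next
  case (relation l r u v)
  then show ?case using pres_rel.relation[of l r R "w @ u" v] by simp
qed (rule pres_rel.refl, erule pres_rel.sym, erule (1) pres_rel.trans)

lemma pres_rel_append_right:
  "(u, v) \<in> pres_rel R \<Longrightarrow> (u @ w, v @ w) \<in> pres_rel R"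
proof (induction rule: pres_rel.induct)
  case (cancel u a b v)
  show ?case using pres_rel.cancel[of u a b "v @ w" R] by simp
next
  case (relation l r u v)
  then show ?case using pres_rel.relation[of l r R u "v @ w"] by simp
qed (rule pres_rel.refl, erule pres_rel.sym, erule (1) pres_rel.trans)

lemma pres_rel_append:
  "(u, u') \<in> pres_rel R \<Longrightarrow> (v, v') \<in> pres_rel R \<Longrightarrow> (u @ v, u' @ v') \<in> pres_rel R"
  by (meson pres_rel.trans pres_rel_append_left pres_rel_append_right)

lemma carrier_presented_group: "carrier (presented_group R) = range (word_class R)"
  by (auto simp: presented_group_def word_class_def quotient_def)

lemma one_presented_group: "\<one>\<^bsub>presented_group R\<^esub> = word_class R []"
  by (simp add: presented_group_def)

lemma mult_presented_group:
  "word_class R u \<otimes>\<^bsub>presented_group R\<^esub> word_class R v = word_class R (u @ v)"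
proof -
  have "word_class R (u' @ v') = word_class R (u @ v)"
    if "u' \<in> word_class R u" "v' \<in> word_class R v" for u' v'
    using that unfolding word_class_eq_iff
    by (simp add: word_class_def pres_rel_append pres_rel.sym)
  moreover have "u \<in> word_class R u" "v \<in> word_class R v"
    by (simp_all add: word_class_def pres_rel.refl)
  ultimately have "(\<Union>u'\<in>word_class R u. \<Union>v'\<in>word_class R v. word_class R (u' @ v'))
      = word_class R (u @ v)"
    by blast
  then show ?thesis
    by (simp add: presented_group_def)
qed

definition word_inverse :: "'g word \<Rightarrow> 'g word" where
  "word_inverse w = rev (map (\<lambda>(a, b). (a, \<not> b)) w)"

lemma word_inverse_left: "(word_inverse w @ w, []) \<in> pres_rel R"
proof (induction w)
  case Nil
  show ?case by (simp add: word_inverse_def pres_rel.refl)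
next
  case (Cons p w)
  obtain a b where p: "p = (a, b)" by (cases p)
  have "(word_inverse w @ [(a, \<not> b), (a, \<not> \<not> b)] @ w, word_inverse w @ w) \<in> pres_rel R"
    by (rule pres_rel.cancel)
  from pres_rel.trans[OF this Cons.IH] show ?case
    by (simp add: word_inverse_def p)
qed

lemma group_presented_group: "group (presented_group R)"
proof (rule groupI)
  fix A assume "A \<in> carrier (presented_group R)"
  then obtain w where "A = word_class R w" by (auto simp: carrier_presented_group)
  then have "word_class R (word_inverse w) \<otimes>\<^bsub>presented_group R\<^esub> A = \<one>\<^bsub>presented_group R\<^esub>"
    by (simp add: mult_presented_group one_presented_group word_class_eq_iff word_inverse_left)
  then show "\<exists>B\<in>carrier (presented_group R). B \<otimes>\<^bsub>presented_group R\<^esub> A = \<one>\<^bsub>presented_group R\<^esub>"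
    by (auto simp: carrier_presented_group)
qed (auto simp: carrier_presented_group mult_presented_group one_presented_group)

section \<open>Centralizers and inner automorphisms\<close>

definition centralizer_in :: "('a, 'b) monoid_scheme \<Rightarrow> 'a set \<Rightarrow> 'a \<Rightarrow> 'a set" where
  "centralizer_in G H a = {h \<in> H. h \<otimes>\<^bsub>G\<^esub> a = a \<otimes>\<^bsub>G\<^esub> h}"

definition inner_automorphisms :: "('a, 'b) monoid_scheme \<Rightarrow> ('a \<Rightarrow> 'a) set" where
  "inner_automorphisms G =
    {(\<lambda>a\<in>carrier G. inv\<^bsub>G\<^esub> c \<otimes>\<^bsub>G\<^esub> a \<otimes>\<^bsub>G\<^esub> c) | c. c \<in> carrier G}"

section \<open>The Baumslag--Gersten group\<close>

datatype bg_gen = gen_x | gen_y | gen_t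

text \<open>The relations \<open>y\<inverse> x y = x x\<close> and \<open>t\<inverse> x t = y\<close>.\<close>

definition bg_relations :: "(bg_gen word \<times> bg_gen word) set" where
  "bg_relations =
    {([(gen_y, False), (gen_x, True), (gen_y, True)], [(gen_x, True), (gen_x, True)]),
     ([(gen_t, False), (gen_x, True), (gen_t, True)], [(gen_y, True)])}"

definition BG :: "bg_gen word set monoid" where
  "BG = presented_group bg_relations"

definition bg_x :: "bg_gen word set" where "bg_x = word_class bg_relations [(gen_x, True)]"
definition bg_y :: "bg_gen word set" where "bg_y = word_class bg_relations [(gen_y, True)]"
definition bg_t :: "bg_gen word set" where "bg_t = word_class bg_relations [(gen_t, True)]"

lemma group_BG: "group BG"
  unfolding BG_def by (rule group_presented_group)

lemma bg_gens_carrier: "bg_x \<in> carrier BG" "bg_y \<in> carrier BG" "bg_t \<in> carrier BG"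
  by (auto simp: BG_def bg_x_def bg_y_def bg_t_def carrier_presented_group)

lemma inv_word_class:
  "inv\<^bsub>presented_group R\<^esub> (word_class R w) = word_class R (word_inverse w)"
  by (rule group.inv_equality[OF group_presented_group])
    (auto simp: mult_presented_group one_presented_group word_class_eq_iff
      word_inverse_left carrier_presented_group)

lemma bg_relation_xy: "inv\<^bsub>BG\<^esub> bg_y \<otimes>\<^bsub>BG\<^esub> bg_x \<otimes>\<^bsub>BG\<^esub> bg_y = bg_x \<otimes>\<^bsub>BG\<^esub> bg_x"
  using pres_rel.relation[of "[(gen_y, False), (gen_x, True), (gen_y, True)]" "[(gen_x, True), (gen_x, True)]"
      bg_relations "[]" "[]"]
  by (simp add: BG_def bg_x_def bg_y_def inv_word_class word_inverse_def
      mult_presented_group word_class_eq_iff) (simp add: bg_relations_def)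

lemma bg_relation_xt: "inv\<^bsub>BG\<^esub> bg_t \<otimes>\<^bsub>BG\<^esub> bg_x \<otimes>\<^bsub>BG\<^esub> bg_t = bg_y"
  using pres_rel.relation[of "[(gen_t, False), (gen_x, True), (gen_t, True)]" "[(gen_y, True)]"
      bg_relations "[]" "[]"]
  by (simp add: BG_def bg_x_def bg_y_def bg_t_def inv_word_class word_inverse_def
      mult_presented_group word_class_eq_iff) (simp add: bg_relations_def)

definition bg_H :: "bg_gen word set set" where
  "bg_H = generate BG {bg_x, bg_y}"

end

theory Submission
  imports Defs
begin

text \<open>
  Write \<open>a = F(x)\<close>, \<open>b = F(y)\<close>, \<open>s = F(t)\<close>, so that \<open>a\<^sup>b = a\<^sup>2\<close> and \<open>a\<^sup>s = b\<close>.  The powers \<open>a\<close>, \<open>a\<^sup>2\<close>, \<open>a\<^sup>4\<close>,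
  \<open>\<dots>\<close> are conjugate by powers of \<open>b\<close>, so their lengths in the HNN extension cannot grow linearly in the
  exponent, and \<open>a\<close> is conjugate into \<open>H\<close>.  Britton's lemma shows that \<open>a\<close> is even conjugate into the normal
  subgroup \<open>N\<close> of \<open>H\<close> isomorphic to \<open>\<int>[1/2]\<close>, and that an element which conjugates a nontrivial element
  of \<open>N\<close> into \<open>N\<close> lies in \<open>H\<close>.  Hence \<open>b \<in> H\<close>, and after conjugation in \<open>H\<close> we have \<open>b = y\<close>.  Now
  \<open>s t\<inverse>\<close> conjugates \<open>a\<close> to \<open>x\<close>, so it lies in \<open>H\<close> and \<open>a\<close> is the conjugate of \<open>x\<close> by a power of \<open>y\<close>;
  after conjugation by this power, \<open>a = x\<close>, \<open>b = y\<close> and \<open>s t\<inverse>\<close> centralizes \<open>x\<close>.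
\<close>

section \<open>Normal forms in an HNN extension\<close>

text \<open>
  The letter \<open>e = True\<close> stands for the stable letter and \<open>e = False\<close> for its inverse;
  the relations are \<open>a t\<^sup>e = t\<^sup>e \<phi>\<^sub>e(a)\<close> for \<open>a \<in> A\<^sub>e\<close>.  The normal form
  \<open>s\<^sub>1 t\<^sup>e\<^sup>1 s\<^sub>2 t\<^sup>e\<^sup>2 \<dots> k\<close>, where each \<open>s\<^sub>i\<close> is the chosen representative of a left coset of
  the associated subgroup, is \<open>Edge s\<^sub>1 e\<^sub>1 (Edge s\<^sub>2 e\<^sub>2 (\<dots> (End k)))\<close>.
\<close>

datatype 'k nform = End 'k | Edge 'k bool "'k nform"

fun depth :: "'k nform \<Rightarrow> nat" where
  "depth (End k) = 0"
| "depth (Edge s e v) = Suc (depth v)"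

locale hnn =
  fixes A :: "bool \<Rightarrow> 'k::group_add set"
    and \<phi> :: "bool \<Rightarrow> 'k \<Rightarrow> 'k"
  assumes zero_mem: "0 \<in> A e"
    and add_mem: "a \<in> A e \<Longrightarrow> b \<in> A e \<Longrightarrow> a + b \<in> A e"
    and uminus_mem: "a \<in> A e \<Longrightarrow> - a \<in> A e"
    and \<phi>_mem: "a \<in> A e \<Longrightarrow> \<phi> e a \<in> A (\<not> e)"
    and \<phi>_add: "a \<in> A e \<Longrightarrow> b \<in> A e \<Longrightarrow> \<phi> e (a + b) = \<phi> e a + \<phi> e b"
    and \<phi>_\<phi>: "a \<in> A e \<Longrightarrow> \<phi> (\<not> e) (\<phi> e a) = a"
begin

text \<open>The subgroup itself is represented by 0, so that a cancelling pair of stable letters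
  shows up in a normal form as a zero entry.\<close>

definition rep :: "bool \<Rightarrow> 'k \<Rightarrow> 'k" where
  "rep e k = (if k \<in> A e then 0 else (SOME s. - s + k \<in> A e))"

lemma rep_coset: "- rep e k + k \<in> A e"
  unfolding rep_def by (auto intro!: someI[of "\<lambda>s. - s + k \<in> A e" k] simp: zero_mem)

lemma rep_cong:
  assumes "- k + k' \<in> A e"
  shows "rep e k = rep e k'"
proof -
  have *: "- s + k \<in> A e \<longleftrightarrow> - s + k' \<in> A e" for s
  proof
    assume "- s + k \<in> A e"
    from add_mem[OF this assms] show "- s + k' \<in> A e"
      by (simp add: add.assoc)
  next
    assume "- s + k' \<in> A e"
    from add_mem[OF this uminus_mem[OF assms]] show "- s + k \<in> A e"
      by (simp add: minus_add add.assoc)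
  qed
  show ?thesis
    using *[of 0] by (simp add: rep_def *)
qed

lemma rep_rep [simp]: "rep e (rep e k) = rep e k"
  by (rule rep_cong) (rule rep_coset)

lemma rep_eq_0_iff: "rep e k = 0 \<longleftrightarrow> k \<in> A e"
  using rep_coset[of e k] by (auto simp: rep_def)

lemma rep_eq_iff: "rep e k = rep e k' \<longleftrightarrow> - k + k' \<in> A e"
proof
  assume eq: "rep e k = rep e k'"
  have "- (- rep e k + k) + (- rep e k' + k') \<in> A e"
    by (intro add_mem uminus_mem rep_coset)
  then show "- k + k' \<in> A e"
    by (simp add: eq minus_add add.assoc)
qed (rule rep_cong)

lemma \<phi>_0 [simp]: "\<phi> e 0 = 0"
  using \<phi>_add[of 0 e 0] add_left_cancel[of "\<phi> e 0" "\<phi> e 0" 0] by (simp add: zero_mem)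

text \<open>Left multiplication by the base group: \<open>k + s\<close> splits as representative
  plus an element of \<open>A e\<close>, which moves past the stable letter through
  \<open>\<phi> e\<close>.\<close>

fun act :: "'k \<Rightarrow> 'k nform \<Rightarrow> 'k nform" where
  "act k (End h) = End (k + h)"
| "act k (Edge s e v) = Edge (rep e (k + s)) e (act (\<phi> e (- rep e (k + s) + (k + s))) v)"

fun stb :: "bool \<Rightarrow> 'k nform \<Rightarrow> 'k nform" where
  "stb e (End h) = Edge 0 e (End h)"
| "stb e (Edge s e' v) = (if e' = (\<not> e) \<and> s = 0 then v else Edge 0 e (Edge s e' v))"

fun pinch :: "bool \<Rightarrow> 'k nform \<Rightarrow> bool" where
  "pinch e (End h) = False"
| "pinch e (Edge s e' v) = (e' = (\<not> e) \<and> s = 0)"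

fun red :: "'k nform \<Rightarrow> bool" where
  "red (End h) = True"
| "red (Edge s e v) = (rep e s = s \<and> red v \<and> \<not> pinch e v)"

lemma stb_no_pinch: "\<not> pinch e v \<Longrightarrow> stb e v = Edge 0 e v"
  by (cases v) auto

lemma depth_act [simp]: "depth (act k v) = depth v"
  by (induction v arbitrary: k) auto

lemma depth_stb_le: "depth (stb e v) \<le> Suc (depth v)"
  by (cases v) auto

text \<open>Translation by an element of a subgroup sends the trivial coset, and no other, to the
  trivial coset.\<close>

lemma pinch_act:
  assumes "red v" "a \<in> A (\<not> e)"
  shows "pinch e (act a v) = pinch e v"
proof (cases v)
  case (Edge s e' w)
  have "rep e' (a + s) = 0 \<longleftrightarrow> s = 0" if "e' = (\<not> e)"
  proof -
    have "a + s \<in> A e' \<longleftrightarrow> s \<in> A e'"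
      using assms(2) that add_mem[of a e' s] add_mem[of "- a" e' "a + s"] uminus_mem[of a e']
      by (auto simp: add.assoc[symmetric])
    then show ?thesis
      using assms(1) Edge by (metis rep_eq_0_iff red.simps(2))
  qed
  then show ?thesis using Edge by auto
qed simp

text \<open>What is carried past an edge \<open>e\<close> lies in \<open>A (\<not> e)\<close>, so
  \<open>pinch_act\<close> excludes new cancellations.\<close>

lemma red_act [simp]: "red v \<Longrightarrow> red (act k v)"
  by (induction v arbitrary: k) (auto simp: pinch_act \<phi>_mem rep_coset)

lemma red_stb [simp]: "red v \<Longrightarrow> red (stb e v)"
  by (cases v) (auto simp: rep_eq_0_iff zero_mem)

lemma act_0 [simp]: "red v \<Longrightarrow> act 0 v = v"
  by (induction v) auto

lemma act_add: "act k (act k' v) = act (k + k') v"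
proof (induction v arbitrary: k k')
  case (Edge s e v)
  define r where "r = rep e (k' + s)"
  have r: "- r + (k' + s) \<in> A e"
    unfolding r_def by (rule rep_coset)
  have eq: "rep e (k + r) = rep e (k + k' + s)"
    by (rule rep_cong) (use r in \<open>simp only: minus_add add.assoc minus_add_cancel\<close>)
  have "\<phi> e (- rep e (k + r) + (k + r)) + \<phi> e (- r + (k' + s))
      = \<phi> e (- rep e (k + r) + (k + r) + (- r + (k' + s)))"
    by (rule \<phi>_add[symmetric]) (use r rep_coset in auto)
  also have "- rep e (k + r) + (k + r) + (- r + (k' + s)) = - rep e (k + k' + s) + (k + k' + s)"
    by (simp add: eq add.assoc)
  finally show ?case
    by (simp add: Edge.IH eq flip: r_def)
qed (simp add: add.assoc)

text \<open>The HNN relation, realised on normal forms. If the letter cancels, it amounts to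
  \<open>\<phi>_\<phi>\<close>; otherwise \<open>a\<close> has trivial coset and passes the new
  edge.\<close>

lemma act_stb:
  assumes "red v" "a \<in> A e"
  shows "act a (stb e v) = stb e (act (\<phi> e a) v)"
proof (cases "pinch e v")
  case True
  then obtain w where v: "v = Edge 0 (\<not> e) w" by (cases v) auto
  have "rep (\<not> e) (\<phi> e a) = 0"
    using assms by (simp add: rep_eq_0_iff \<phi>_mem)
  then show ?thesis using assms by (simp add: v \<phi>_\<phi>)
next
  case False
  then have "\<not> pinch e (act (\<phi> e a) v)"
    using assms by (simp add: pinch_act \<phi>_mem)
  moreover have "rep e a = 0"
    using assms by (simp add: rep_eq_0_iff)
  ultimately show ?thesis using False by (simp add: stb_no_pinch)
qed

text \<open>If the first letter cancels an edge, reducedness of \<open>v\<close> prevents its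
  inverse from cancelling further, so that the edge is restored.\<close>

lemma stb_stb [simp]:
  assumes "red v"
  shows "stb (\<not> e) (stb e v) = v"
proof (cases "pinch e v")
  case True
  then obtain w where v: "v = Edge 0 (\<not> e) w" by (cases v) auto
  show ?thesis using assms by (simp add: v stb_no_pinch)
next
  case False
  then show ?thesis by (simp add: stb_no_pinch)
qed

section \<open>Words without pinches and Britton's lemma\<close>

definition no_pinch :: "'k \<times> bool \<Rightarrow> 'k \<times> bool \<Rightarrow> bool" where
  "no_pinch p q \<longleftrightarrow> \<not> (snd q = (\<not> snd p) \<and> fst q \<in> A (snd q))"

definition word_act :: "('k \<times> bool) list \<Rightarrow> 'k nform \<Rightarrow> 'k nform" where
  "word_act ws v = foldr (\<lambda>(h, e) v. act h (stb e v)) ws v"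

lemma word_act_simps [simp]:
  "word_act [] v = v"
  "word_act ((h, e) # ws) v = act h (stb e (word_act ws v))"
  by (simp_all add: word_act_def)

lemma red_word_act [simp]: "red v \<Longrightarrow> red (word_act ws v)"
  by (induction ws) auto

lemma depth_word_act_le: "depth (word_act ws v) \<le> length ws + depth v"
proof (induction ws)
  case (Cons p ws)
  then show ?case
    using depth_stb_le[of "snd p" "word_act ws v"] by (cases p) auto
qed simp

text \<open>Without pinches each stable letter adds an edge. The description of the first edge is
  what shows in the induction that the next letter does not cancel; it also serves later to compare
  cosets.\<close>

lemma Britton:
  assumes "successively no_pinch ws"
  shows "depth (word_act ws (End k)) = length ws \<and>
    (case ws of [] \<Rightarrow> True | (h, e) # _ \<Rightarrow> \<exists>v. word_act ws (End k) = Edge (rep e h) e v)"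
  using assms
proof (induction ws)
  case (Cons p ws)
  obtain h e where p: "p = (h, e)" by (cases p)
  have "\<not> pinch e (word_act ws (End k))"
    using Cons by (auto simp: successively_Cons no_pinch_def p rep_eq_0_iff split: list.splits)
  moreover have "successively no_pinch ws"
    using Cons.prems by (auto simp: successively_Cons)
  ultimately show ?case
    using Cons.IH by (simp add: p stb_no_pinch)
qed simp

end

section \<open>The rational affine group\<close>

text \<open>
  \<open>Aff q n\<close> is the map \<open>r \<mapsto> q + r / 2\<^sup>n\<close>; the images of \<open>x\<close> and \<open>y\<close> are \<open>Aff 1 0\<close> and \<open>Aff 0 1\<close>.
\<close>

datatype aff = Aff (shift: rat) (expo: int)

instantiation aff :: group_add
begin

definition zero_aff :: aff where "0 = Aff 0 0"

fun plus_aff :: "aff \<Rightarrow> aff \<Rightarrow> aff" where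
  "Aff q n + Aff r m = Aff (q + 2 powi (- n) * r) (n + m)"

fun uminus_aff :: "aff \<Rightarrow> aff" where
  "- Aff q n = Aff (- (2 powi n * q)) (- n)"

definition minus_aff :: "aff \<Rightarrow> aff \<Rightarrow> aff" where
  "a - b = a + - (b :: aff)"

instance
proof
  fix a b c :: aff
  show "a + b + c = a + (b + c)"
    by (cases a; cases b; cases c) (simp add: power_int_add power_int_diff field_simps power_int_minus)
  show "0 + a = a" by (cases a) (simp add: zero_aff_def)
  show "a + 0 = a" by (cases a) (simp add: zero_aff_def)
  show "- a + a = 0" by (cases a) (simp add: zero_aff_def)
  show "a + - b = a - b" by (simp add: minus_aff_def)
qed

end

lemma expo_add [simp]: "expo (a + b) = expo a + expo b"
  by (cases a; cases b) simp

lemma expo_uminus [simp]: "expo (- a) = - expo a"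
  by (cases a) simp

text \<open>The cyclic groups generated by the images of \<open>x\<close> and of
  \<open>y\<close>.\<close>

definition assoc_subgroup :: "bool \<Rightarrow> aff set" where
  "assoc_subgroup e = (if e then {Aff (of_int m) 0 | m. True} else {Aff 0 m | m. True})"

text \<open>The isomorphism taking \<open>x^m\<close> to \<open>y^m\<close>, and its inverse; the
  floor turns the integral rational shift back into an integer.\<close>

fun assoc_iso :: "bool \<Rightarrow> aff \<Rightarrow> aff" where
  "assoc_iso e (Aff q n) = (if e then Aff 0 \<lfloor>q\<rfloor> else Aff (of_int n) 0)"

interpretation bg: hnn assoc_subgroup assoc_iso
proof
  show "0 \<in> assoc_subgroup e" for e
    by (cases e) (auto simp: assoc_subgroup_def zero_aff_def intro: exI[of _ 0])
  show "a + b \<in> assoc_subgroup e" if "a \<in> assoc_subgroup e" "b \<in> assoc_subgroup e" for a b e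
    using that by (auto simp: assoc_subgroup_def split: if_splits simp flip: of_int_add)
  show "- a \<in> assoc_subgroup e" if "a \<in> assoc_subgroup e" for a e
    using that by (auto simp: assoc_subgroup_def split: if_splits simp flip: of_int_minus)
  show "assoc_iso e a \<in> assoc_subgroup (\<not> e)" if "a \<in> assoc_subgroup e" for a e
    using that by (auto simp: assoc_subgroup_def split: if_splits)
  show "assoc_iso e (a + b) = assoc_iso e a + assoc_iso e b"
    if "a \<in> assoc_subgroup e" "b \<in> assoc_subgroup e" for a b e
    using that by (auto simp: assoc_subgroup_def split: if_splits)
  show "assoc_iso (\<not> e) (assoc_iso e a) = a" if "a \<in> assoc_subgroup e" for a e
    using that by (auto simp: assoc_subgroup_def split: if_splits)
qed

section \<open>Homomorphisms out of a presented group\<close>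

definition eval_word :: "('a, 'b) monoid_scheme \<Rightarrow> ('g \<Rightarrow> 'a) \<Rightarrow> 'g word \<Rightarrow> 'a" where
  "eval_word M f w = foldr (\<lambda>(a, b) z. (if b then f a else inv\<^bsub>M\<^esub> f a) \<otimes>\<^bsub>M\<^esub> z) w \<one>\<^bsub>M\<^esub>"

lemma (in group) eval_word_closed:
  assumes "\<And>a. f a \<in> carrier G"
  shows "eval_word G f w \<in> carrier G"
  by (induction w) (auto simp: eval_word_def assms)

lemma (in group) inv_cancel:
  assumes "a \<in> carrier G" "b \<in> carrier G"
  shows "inv a \<otimes> (a \<otimes> b) = b" "a \<otimes> (inv a \<otimes> b) = b"
  using assms by (simp_all add: m_assoc[symmetric])

lemma (in group) eval_word_append:
  assumes "\<And>a. f a \<in> carrier G"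
  shows "eval_word G f (u @ v) = eval_word G f u \<otimes> eval_word G f v"
proof (induction u)
  case (Cons p u)
  obtain a b where p: "p = (a, b)" by (cases p)
  have "eval_word G f (p # w) = (if b then f a else inv f a) \<otimes> eval_word G f w" for w
    by (simp add: eval_word_def p)
  then show ?case
    using Cons assms by (simp add: eval_word_closed m_assoc)
qed (use assms eval_word_closed[of f v] in \<open>simp add: eval_word_def\<close>)

lemma (in group) eval_word_pres_rel:
  assumes "(u, v) \<in> pres_rel R" "\<And>a. f a \<in> carrier G"
    and "\<And>l r. (l, r) \<in> R \<Longrightarrow> eval_word G f l = eval_word G f r"
  shows "eval_word G f u = eval_word G f v"
  using assms(1)
proof (induction rule: pres_rel.induct)
  case (cancel u a b v)
  have "eval_word G f [(a, b), (a, \<not> b)] = \<one>"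
    by (simp add: eval_word_def assms(2))
  then show ?case
    by (simp only: eval_word_append[of f, OF assms(2)]) (simp add: eval_word_closed assms(2))
qed (simp_all add: eval_word_append assms)

text \<open>Von Dyck's theorem: a class is evaluated at a chosen word, and
  \<open>eval_word_pres_rel\<close> shows that the choice does not matter.\<close>

lemma (in group) presented_group_hom:
  assumes "\<And>a. f a \<in> carrier G"
    and "\<And>l r. (l, r) \<in> R \<Longrightarrow> eval_word G f l = eval_word G f r"
  obtains E where "E \<in> hom (presented_group R) G" "\<And>w. E (word_class R w) = eval_word G f w"
proof
  define E where "E A = eval_word G f (SOME w. word_class R w = A)" for A
  show E: "E (word_class R w) = eval_word G f w" for w
  proof -
    have "word_class R (SOME w'. word_class R w' = word_class R w) = word_class R w"
      by (rule someI) simp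
    then show ?thesis
      using eval_word_pres_rel[OF _ assms] by (simp add: E_def word_class_eq_iff)
  qed
  show "E \<in> hom (presented_group R) G"
    by (auto simp: hom_def carrier_presented_group mult_presented_group E
        eval_word_append eval_word_closed assms(1))
qed

lemma (in group) BG_hom:
  assumes "a \<in> carrier G" "b \<in> carrier G" "c \<in> carrier G"
    and "inv b \<otimes> a \<otimes> b = a \<otimes> a" "inv c \<otimes> a \<otimes> c = b"
  obtains E where "E \<in> hom BG G" "E bg_x = a" "E bg_y = b" "E bg_t = c"
proof -
  define f where "f = case_bg_gen a b c"
  have f: "f s \<in> carrier G" for s
    using assms by (cases s) (auto simp: f_def)
  have rel: "eval_word G f l = eval_word G f r" if "(l, r) \<in> bg_relations" for l r
    using that assms by (auto simp: bg_relations_def eval_word_def f_def m_assoc)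
  from presented_group_hom[OF f rel] obtain E where
    "E \<in> hom (presented_group bg_relations) G"
    and "\<And>w. E (word_class bg_relations w) = eval_word G f w"
    by blast
  with assms show ?thesis
    by (intro that[of E]) (auto simp: BG_def bg_x_def bg_y_def bg_t_def eval_word_def f_def)
qed

section \<open>Conjugation\<close>

context group
begin

definition conjugate :: "'a \<Rightarrow> 'a \<Rightarrow> 'a" where
  "conjugate c a = inv c \<otimes> a \<otimes> c"

lemma conjugate_closed [simp]:
  "c \<in> carrier G \<Longrightarrow> a \<in> carrier G \<Longrightarrow> conjugate c a \<in> carrier G"
  by (simp add: conjugate_def)

lemma conjugate_by_one [simp]: "a \<in> carrier G \<Longrightarrow> conjugate \<one> a = a"
  by (simp add: conjugate_def)

lemma conjugate_one [simp]: "c \<in> carrier G \<Longrightarrow> conjugate c \<one> = \<one>"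
  by (simp add: conjugate_def)

lemma conjugate_mult:
  assumes "c \<in> carrier G" "a \<in> carrier G" "b \<in> carrier G"
  shows "conjugate c (a \<otimes> b) = conjugate c a \<otimes> conjugate c b"
  using assms by (simp add: conjugate_def m_assoc inv_cancel)

text \<open>Cyclic permutation of a product, used for cyclic reduction.\<close>

lemma conjugate_mult_self:
  "c \<in> carrier G \<Longrightarrow> a \<in> carrier G \<Longrightarrow> conjugate c (c \<otimes> a) = a \<otimes> c"
  by (simp add: conjugate_def m_assoc inv_cancel)

lemma conjugate_conjugate:
  assumes "c \<in> carrier G" "d \<in> carrier G" "a \<in> carrier G"
  shows "conjugate d (conjugate c a) = conjugate (c \<otimes> d) a"
  using assms by (simp add: conjugate_def m_assoc inv_mult_group)

lemma conjugate_conjugate_inv [simp]: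
  assumes "c \<in> carrier G" "a \<in> carrier G"
  shows "conjugate (inv c) (conjugate c a) = a" "conjugate c (conjugate (inv c) a) = a"
  using assms by (simp_all add: conjugate_conjugate)

lemma conjugate_eq_one_iff [simp]:
  assumes "c \<in> carrier G" "a \<in> carrier G"
  shows "conjugate c a = \<one> \<longleftrightarrow> a = \<one>"
  using conjugate_conjugate_inv(1)[OF assms] assms by (metis conjugate_one inv_closed)

lemma conjugate_distrib:
  assumes "c \<in> carrier G" "b \<in> carrier G" "a \<in> carrier G"
  shows "conjugate (conjugate c b) (conjugate c a) = conjugate c (conjugate b a)"
  using assms by (simp add: conjugate_def m_assoc inv_mult_group inv_cancel)

lemma conjugate_inv:
  assumes "c \<in> carrier G" "a \<in> carrier G"
  shows "conjugate c (inv a) = inv (conjugate c a)"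
  using assms by (simp add: conjugate_def m_assoc inv_mult_group)

lemma conjugate_pow:
  assumes "c \<in> carrier G" "a \<in> carrier G"
  shows "conjugate c (a [^] (n :: nat)) = conjugate c a [^] n"
  by (induction n) (simp_all add: assms conjugate_mult)

lemma conjugate_int_pow:
  assumes "c \<in> carrier G" "a \<in> carrier G"
  shows "conjugate c (a [^] (n :: int)) = conjugate c a [^] n"
proof (cases n rule: int_cases2)
  case (nonneg m)
  then show ?thesis using assms by (simp add: int_pow_int conjugate_pow)
next
  case (nonpos m)
  then show ?thesis using assms by (simp add: int_pow_neg_int conjugate_inv conjugate_pow)
qed

end

section \<open>The action of the Baumslag--Gersten group on normal forms\<close>

interpretation BG: group BG
  by (rule group_BG)

abbreviation bg_mult (infixl "\<bullet>" 70) where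
  "a \<bullet> b \<equiv> a \<otimes>\<^bsub>BG\<^esub> b"

declare bg_gens_carrier [simp]

lemma BG_induct [consumes 1, case_names one step]:
  assumes "g \<in> carrier BG" "P \<one>\<^bsub>BG\<^esub>"
    and step: "\<And>s g. s \<in> {bg_x, bg_y, bg_t} \<Longrightarrow> g \<in> carrier BG \<Longrightarrow> P g \<Longrightarrow>
      P (s \<bullet> g) \<and> P (inv\<^bsub>BG\<^esub> s \<bullet> g)"
  shows "P g"
proof -
  have "P (word_class bg_relations w)" for w
  proof (induction w)
    case Nil
    then show ?case using assms(2) by (simp add: BG_def one_presented_group)
  next
    case (Cons p w)
    obtain a b where p: "p = (a, b)" by (cases p)
    have w: "word_class bg_relations w \<in> carrier BG"
      by (simp add: BG_def carrier_presented_group)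
    have eq: "word_class bg_relations (p # w)
        = word_class bg_relations [(a, b)] \<bullet> word_class bg_relations w"
      by (simp add: BG_def mult_presented_group p)
    have inv: "word_class bg_relations [(a, False)]
        = inv\<^bsub>BG\<^esub> (word_class bg_relations [(a, True)])"
      by (simp add: BG_def inv_word_class word_inverse_def)
    have "word_class bg_relations [(a, True)] \<in> {bg_x, bg_y, bg_t}"
      by (cases a) (auto simp: bg_x_def bg_y_def bg_t_def)
    from step[OF this w Cons.IH] show ?case
      by (cases b) (auto simp: eq inv)
  qed
  then show ?thesis
    using assms(1) by (auto simp: BG_def carrier_presented_group)
qed

fun letter_act :: "bg_gen \<times> bool \<Rightarrow> aff nform \<Rightarrow> aff nform" where
  "letter_act (gen_x, b) = bg.act (if b then Aff 1 0 else - Aff 1 0)"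
| "letter_act (gen_y, b) = bg.act (if b then Aff 0 1 else - Aff 0 1)"
| "letter_act (gen_t, b) = bg.stb b"

lemma red_letter_act [simp]: "bg.red v \<Longrightarrow> bg.red (letter_act p v)"
  by (induction p rule: letter_act.induct) auto

lemma red_letters_act [simp]: "bg.red v \<Longrightarrow> bg.red (foldr letter_act w v)"
  by (induction w) auto

text \<open>The action descends to \<open>BG\<close>: the relation between \<open>x\<close> and
  \<open>y\<close> already holds for affine maps, and the one with \<open>t\<close> comes from
  \<open>act_stb\<close>.\<close>

lemma letters_act_pres_rel:
  assumes "(u, u') \<in> pres_rel bg_relations" "bg.red v"
  shows "foldr letter_act u v = foldr letter_act u' v"
  using assms
proof (induction arbitrary: v rule: pres_rel.induct)
  case (cancel u a b w)
  have "letter_act (a, b) (letter_act (a, \<not> b) v') = v'" if "bg.red v'" for v'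
    using that bg.stb_stb[of v' "\<not> b"] by (cases a) (auto simp: bg.act_add simp flip: zero_aff_def)
  with cancel show ?case by simp
next
  case (relation l r u w)
  have "foldr letter_act l v' = foldr letter_act r v'" if "bg.red v'" for v'
  proof -
    have "Aff 1 0 \<in> assoc_subgroup True"
      by (auto simp: assoc_subgroup_def intro: exI[of _ 1])
    from bg.act_stb[OF that this] bg.stb_stb[of "bg.act (Aff 0 1) v'" True] that
    have "bg.stb False (bg.act (Aff 1 0) (bg.stb True v')) = bg.act (Aff 0 1) v'"
      by simp
    then show ?thesis
      using relation.hyps by (auto simp: bg_relations_def bg.act_add)
  qed
  with relation.prems show ?case by simp
qed auto

definition gact :: "bg_gen word set \<Rightarrow> aff nform \<Rightarrow> aff nform" where
  "gact g v = foldr letter_act (SOME w. word_class bg_relations w = g) v"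

lemma gact_word_class:
  assumes "bg.red v"
  shows "gact (word_class bg_relations w) v = foldr letter_act w v"
proof -
  have "word_class bg_relations (SOME w'. word_class bg_relations w' = word_class bg_relations w)
      = word_class bg_relations w"
    by (rule someI) simp
  then show ?thesis
    using letters_act_pres_rel[OF _ assms] by (simp add: gact_def word_class_eq_iff)
qed

lemma red_gact [simp]: "bg.red v \<Longrightarrow> bg.red (gact g v)"
  by (simp add: gact_def)

lemma gact_mult:
  assumes "g \<in> carrier BG" "h \<in> carrier BG" "bg.red v"
  shows "gact (g \<bullet> h) v = gact g (gact h v)"
  using assms
  by (auto simp: BG_def carrier_presented_group mult_presented_group gact_word_class)

lemma gact_one [simp]: "bg.red v \<Longrightarrow> gact \<one>\<^bsub>BG\<^esub> v = v"
  by (simp add: BG_def one_presented_group gact_word_class)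

lemma gact_gens:
  assumes "bg.red v"
  shows "gact bg_x v = bg.act (Aff 1 0) v" "gact bg_y v = bg.act (Aff 0 1) v"
    "gact bg_t v = bg.stb True v"
  using assms by (simp_all add: bg_x_def bg_y_def bg_t_def gact_word_class)

lemma gact_inv_t: "bg.red v \<Longrightarrow> gact (inv\<^bsub>BG\<^esub> bg_t) v = bg.stb False v"
  by (simp add: bg_t_def BG_def inv_word_class word_inverse_def gact_word_class)

lemma gact_inv_H:
  assumes "g \<in> carrier BG" "\<And>v. bg.red v \<Longrightarrow> gact g v = bg.act k v" "bg.red v"
  shows "gact (inv\<^bsub>BG\<^esub> g) v = bg.act (- k) v"
proof -
  have "gact (inv\<^bsub>BG\<^esub> g) v = gact (inv\<^bsub>BG\<^esub> g) (gact g (bg.act (- k) v))"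
    by (simp add: assms bg.act_add)
  also have "\<dots> = gact (inv\<^bsub>BG\<^esub> g \<bullet> g) (bg.act (- k) v)"
    by (rule gact_mult[symmetric]) (simp_all add: assms)
  also have "\<dots> = bg.act (- k) v"
    by (simp add: assms)
  finally show ?thesis .
qed

section \<open>The Baumslag--Solitar subgroup\<close>

lemma subgroup_bg_H: "subgroup bg_H BG"
  unfolding bg_H_def by (rule BG.generate_is_subgroup) simp

lemma bg_H_carrier [simp]: "h \<in> bg_H \<Longrightarrow> h \<in> carrier BG"
  by (rule subgroup.mem_carrier[OF subgroup_bg_H])

lemma bg_H_closed [simp]:
  "bg_x \<in> bg_H" "bg_y \<in> bg_H" "\<one>\<^bsub>BG\<^esub> \<in> bg_H"
  "g \<in> bg_H \<Longrightarrow> h \<in> bg_H \<Longrightarrow> g \<bullet> h \<in> bg_H"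
  "g \<in> bg_H \<Longrightarrow> inv\<^bsub>BG\<^esub> g \<in> bg_H"
  using subgroup_bg_H
  by (auto simp: subgroup_def bg_H_def intro: generate.incl)

lemma bg_H_pow [simp]:
  assumes "g \<in> bg_H"
  shows "g [^]\<^bsub>BG\<^esub> (n :: nat) \<in> bg_H"
  by (induction n) (simp_all add: assms)

lemma bg_H_int_pow [simp]: "g \<in> bg_H \<Longrightarrow> g [^]\<^bsub>BG\<^esub> (n :: int) \<in> bg_H"
  by (cases n rule: int_cases2) (simp_all add: int_pow_int BG.int_pow_neg_int)

lemma bg_H_conjugate [simp]: "g \<in> bg_H \<Longrightarrow> h \<in> bg_H \<Longrightarrow> BG.conjugate g h \<in> bg_H"
  by (simp add: BG.conjugate_def)

text \<open>On \<open>H\<close> this is the homomorphism to the affine group, read off from the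
  orbit of \<open>End 0\<close>.\<close>

definition kap :: "bg_gen word set \<Rightarrow> aff" where
  "kap g = (THE k. gact g (End 0) = End k)"

lemma gact_bg_H:
  assumes "g \<in> bg_H" "bg.red v"
  shows "gact g v = bg.act (kap g) v"
proof -
  \<comment> \<open>One \<open>k\<close> must serve all \<open>v\<close> for the product case;
    evaluation at \<open>End 0\<close> then identifies it as \<open>kap g\<close>.\<close>
  have "\<exists>k. \<forall>v. bg.red v \<longrightarrow> gact g v = bg.act k v"
    using assms(1) unfolding bg_H_def
  proof (induction rule: generate.induct)
    case (inv h)
    then show ?case by (auto simp: gact_inv_H[OF _ gact_gens(1)] gact_inv_H[OF _ gact_gens(2)])
  next
    case (eng g h)
    then have "g \<in> carrier BG" "h \<in> carrier BG" by (auto simp flip: bg_H_def)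
    with eng show ?case by (metis gact_mult bg.act_add bg.red_act)
  qed (use gact_gens in \<open>auto intro: exI[of _ 0]\<close>)
  then obtain k where k: "\<And>v. bg.red v \<Longrightarrow> gact g v = bg.act k v" by blast
  moreover from k[of "End 0"] have "kap g = k" by (simp add: kap_def)
  ultimately show ?thesis using assms by simp
qed

lemma kap_eqI: "g \<in> bg_H \<Longrightarrow> gact g (End 0) = End k \<Longrightarrow> kap g = k"
  by (simp add: gact_bg_H)

lemma kap_simps [simp]:
  "kap bg_x = Aff 1 0" "kap bg_y = Aff 0 1" "kap \<one>\<^bsub>BG\<^esub> = 0"
  by (simp_all add: kap_eqI gact_gens flip: zero_aff_def)

lemma kap_mult [simp]:
  assumes "g \<in> bg_H" "h \<in> bg_H"
  shows "kap (g \<bullet> h) = kap g + kap h"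
proof (rule kap_eqI)
  show "gact (g \<bullet> h) (End 0) = End (kap g + kap h)"
    using assms by (subst gact_mult) (simp_all add: gact_bg_H)
qed (simp add: assms)

lemma kap_inv [simp]:
  assumes "g \<in> bg_H"
  shows "kap (inv\<^bsub>BG\<^esub> g) = - kap g"
  using assms kap_mult[of "inv\<^bsub>BG\<^esub> g" g] by (simp add: eq_neg_iff_add_eq_0)

lemma kap_conjugate:
  "g \<in> bg_H \<Longrightarrow> h \<in> bg_H \<Longrightarrow> kap (BG.conjugate g h) = - kap g + kap h + kap g"
  by (simp add: BG.conjugate_def)

lemma kap_pow:
  "kap (bg_x [^]\<^bsub>BG\<^esub> (n :: nat)) = Aff (of_nat n) 0"
  "kap (bg_y [^]\<^bsub>BG\<^esub> (n :: nat)) = Aff 0 (int n)"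
  by (induction n) (simp_all add: zero_aff_def)

lemma kap_int_pow:
  "kap (bg_x [^]\<^bsub>BG\<^esub> (m :: int)) = Aff (of_int m) 0"
  "kap (bg_y [^]\<^bsub>BG\<^esub> (m :: int)) = Aff 0 m"
  by (cases m rule: int_cases2; simp add: int_pow_int BG.int_pow_neg_int kap_pow)+

section \<open>The relations as conjugations, normal forms in \<open>H\<close>, and faithfulness of
  the affine image\<close>

lemma conjugate_y_x: "BG.conjugate bg_y bg_x = bg_x \<bullet> bg_x"
  by (simp add: BG.conjugate_def bg_relation_xy)

lemma conjugate_t_x: "BG.conjugate bg_t bg_x = bg_y"
  by (simp add: BG.conjugate_def bg_relation_xt)

lemma conjugate_y_pow_x:
  "BG.conjugate (bg_y [^]\<^bsub>BG\<^esub> i) (bg_x [^]\<^bsub>BG\<^esub> (m :: int)) = bg_x [^]\<^bsub>BG\<^esub> (2 ^ i * m)"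
proof (induction i)
  case (Suc i)
  have "bg_x \<bullet> bg_x = bg_x [^]\<^bsub>BG\<^esub> (2 :: int)"
    using BG.int_pow_mult[of bg_x 1 1] by simp
  then have "BG.conjugate bg_y (bg_x [^]\<^bsub>BG\<^esub> (2 ^ i * m)) = bg_x [^]\<^bsub>BG\<^esub> (2 ^ Suc i * m)"
    by (simp add: BG.conjugate_int_pow conjugate_y_x BG.int_pow_pow mult_ac)
  then show ?case
    by (simp add: BG.conjugate_conjugate flip: Suc)
qed simp

text \<open>Positive powers of \<open>y\<close> move to the left past powers of \<open>x\<close> and
  negative ones to the right, doubling the exponent of \<open>x\<close> at each letter. Hence these
  products are stable under left multiplication by \<open>H\<close>.\<close>

lemma bg_H_normal_form:
  assumes "h \<in> bg_H"
  obtains i j :: nat and m :: int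
  where "h = bg_y [^]\<^bsub>BG\<^esub> i \<bullet> bg_x [^]\<^bsub>BG\<^esub> m \<bullet> inv\<^bsub>BG\<^esub> (bg_y [^]\<^bsub>BG\<^esub> j)"
proof -
  define nf where "nf i m j = bg_y [^]\<^bsub>BG\<^esub> i \<bullet> bg_x [^]\<^bsub>BG\<^esub> m \<bullet> inv\<^bsub>BG\<^esub> (bg_y [^]\<^bsub>BG\<^esub> j)"
    for i j :: nat and m :: int
  have comm: "bg_x [^]\<^bsub>BG\<^esub> m \<bullet> bg_y [^]\<^bsub>BG\<^esub> i = bg_y [^]\<^bsub>BG\<^esub> i \<bullet> bg_x [^]\<^bsub>BG\<^esub> (2 ^ i * m)"
    for m :: int and i :: nat
    by (simp add: BG.conjugate_def BG.m_assoc BG.inv_cancel flip: conjugate_y_pow_x)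
  have x: "bg_x [^]\<^bsub>BG\<^esub> l \<bullet> nf i m j = nf i (2 ^ i * l + m) j" for i j :: nat and l m :: int
    using comm[of l i] by (simp add: nf_def BG.int_pow_mult flip: BG.m_assoc)
  have y: "bg_y \<bullet> nf i m j = nf (Suc i) m j" for i j m
    unfolding nf_def by (subst BG.nat_pow_Suc2) (simp_all add: BG.m_assoc)
  have y': "inv\<^bsub>BG\<^esub> bg_y \<bullet> nf i m j = (case i of 0 \<Rightarrow> nf 0 (2 * m) (Suc j) | Suc i \<Rightarrow> nf i m j)"
    for i j m
  proof (cases i)
    case 0
    have "inv\<^bsub>BG\<^esub> bg_y \<bullet> bg_x [^]\<^bsub>BG\<^esub> m = bg_x [^]\<^bsub>BG\<^esub> (2 * m) \<bullet> inv\<^bsub>BG\<^esub> bg_y"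
      using conjugate_y_pow_x[of 1 m, symmetric] by (simp add: BG.conjugate_def BG.m_assoc)
    then show ?thesis
      using 0 by (simp add: nf_def BG.inv_mult_group flip: BG.m_assoc)
  next
    case (Suc i')
    have "inv\<^bsub>BG\<^esub> bg_y \<bullet> (bg_y \<bullet> nf i' m j) = nf i' m j"
      by (rule BG.inv_cancel) (simp_all add: nf_def)
    then show ?thesis by (simp add: Suc y)
  qed
  have "\<forall>i m j. \<exists>i' m' j'. h \<bullet> nf i m j = nf i' m' j'"
    using assms unfolding bg_H_def
  proof (induction rule: generate.induct)
    case one
    have "\<one>\<^bsub>BG\<^esub> \<bullet> nf i m j = nf i m j" for i m j by (simp add: nf_def)
    then show ?case by metis
  next
    case (incl h)
    moreover have "bg_x [^]\<^bsub>BG\<^esub> (1 :: int) = bg_x"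
      by simp
    ultimately show ?case using x[of 1] y by auto blast+
  next
    case (inv h)
    have "bg_x [^]\<^bsub>BG\<^esub> (- 1 :: int) = inv\<^bsub>BG\<^esub> bg_x"
      using BG.int_pow_neg[of bg_x 1] by simp
    with inv show ?case using x[of "- 1"] y' by (auto split: nat.splits) blast+
  next
    case (eng g h)
    then have "g \<in> carrier BG" "h \<in> carrier BG" by (auto simp flip: bg_H_def)
    moreover have "nf i m j \<in> carrier BG" for i m j by (simp add: nf_def)
    ultimately show ?case using eng.IH by (metis BG.m_assoc)
  qed
  then obtain i m j where "h \<bullet> nf 0 0 0 = nf i m j" by blast
  with assms that show ?thesis by (simp add: nf_def)
qed

text \<open>The image of \<open>y^i x^m y^-j\<close> has exponent \<open>i - j\<close>, and its
  shift is a nonzero multiple of \<open>m\<close>. By faithfulness, equations in \<open>H\<close>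
  can be checked on affine maps.\<close>

lemma kap_eq_0:
  assumes "h \<in> bg_H" "kap h = 0"
  shows "h = \<one>\<^bsub>BG\<^esub>"
proof -
  obtain i j :: nat and m :: int
    where h: "h = bg_y [^]\<^bsub>BG\<^esub> i \<bullet> bg_x [^]\<^bsub>BG\<^esub> m \<bullet> inv\<^bsub>BG\<^esub> (bg_y [^]\<^bsub>BG\<^esub> j)"
    using bg_H_normal_form[OF assms(1)] .
  have "m = 0 \<and> i = j"
    using assms(2) by (simp add: h kap_pow kap_int_pow zero_aff_def)
  then show ?thesis by (simp add: h)
qed

lemma kap_inject:
  assumes "g \<in> bg_H" "h \<in> bg_H" "kap g = kap h"
  shows "g = h"
proof -
  have "inv\<^bsub>BG\<^esub> g \<bullet> h = \<one>\<^bsub>BG\<^esub>"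
    by (rule kap_eq_0) (simp_all add: assms)
  then have "g \<bullet> (inv\<^bsub>BG\<^esub> g \<bullet> h) = g"
    using assms by simp
  then show ?thesis using assms by (simp add: BG.inv_cancel)
qed

section \<open>Reduced words\<close>

definition stable :: "bool \<Rightarrow> bg_gen word set" where
  "stable e = (if e then bg_t else inv\<^bsub>BG\<^esub> bg_t)"

lemma stable_carrier [simp]: "stable e \<in> carrier BG"
  by (simp add: stable_def)

lemma inv_stable [simp]: "inv\<^bsub>BG\<^esub> (stable e) = stable (\<not> e)"
  by (simp add: stable_def)

lemma gact_stable: "bg.red v \<Longrightarrow> gact (stable e) v = bg.stb e v"
  by (simp add: stable_def gact_gens gact_inv_t)

text \<open>By injectivity of \<open>kap\<close>, the element is a power of \<open>x\<close> or of
  \<open>y\<close>, and the stable letter exchanges these powers.\<close>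

lemma conjugate_stable:
  assumes "h \<in> bg_H" "kap h \<in> assoc_subgroup e"
  shows "BG.conjugate (stable e) h \<in> bg_H"
    and "kap (BG.conjugate (stable e) h) = assoc_iso e (kap h)"
proof -
  have t: "BG.conjugate bg_t (bg_x [^]\<^bsub>BG\<^esub> (m :: int)) = bg_y [^]\<^bsub>BG\<^esub> m" for m
    by (simp add: BG.conjugate_int_pow conjugate_t_x)
  have "BG.conjugate (stable e) h \<in> bg_H \<and>
      kap (BG.conjugate (stable e) h) = assoc_iso e (kap h)"
  proof (cases e)
    case True
    then obtain m where m: "kap h = Aff (of_int m) 0"
      using assms(2) by (auto simp: assoc_subgroup_def)
    then have "h = bg_x [^]\<^bsub>BG\<^esub> m"
      using assms(1) by (intro kap_inject) (simp_all add: kap_int_pow)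
    then show ?thesis
      using True by (simp add: stable_def t kap_int_pow)
  next
    case False
    then obtain m where m: "kap h = Aff 0 m"
      using assms(2) by (auto simp: assoc_subgroup_def)
    then have "h = bg_y [^]\<^bsub>BG\<^esub> m"
      using assms(1) by (intro kap_inject) (simp_all add: kap_int_pow)
    then have "BG.conjugate (inv\<^bsub>BG\<^esub> bg_t) h = bg_x [^]\<^bsub>BG\<^esub> m"
      by (simp flip: t)
    then show ?thesis
      using False m by (simp add: stable_def kap_int_pow)
  qed
  then show "BG.conjugate (stable e) h \<in> bg_H"
    and "kap (BG.conjugate (stable e) h) = assoc_iso e (kap h)"
    by simp_all
qed

section \<open>Reduced words over \<open>H\<close> and the stable letter\<close>

definition word_prod :: "(bg_gen word set \<times> bool) list \<Rightarrow> bg_gen word set" where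
  "word_prod ws = foldr (\<lambda>(h, e) z. h \<bullet> (stable e \<bullet> z)) ws \<one>\<^bsub>BG\<^esub>"

definition kap_word :: "(bg_gen word set \<times> bool) list \<Rightarrow> (aff \<times> bool) list" where
  "kap_word ws = map (\<lambda>(h, e). (kap h, e)) ws"

definition reduced :: "(bg_gen word set \<times> bool) list \<Rightarrow> bool" where
  "reduced ws \<longleftrightarrow> fst ` set ws \<subseteq> bg_H \<and> successively bg.no_pinch (kap_word ws)"

lemma word_prod_simps [simp]:
  "word_prod [] = \<one>\<^bsub>BG\<^esub>"
  "word_prod ((h, e) # ws) = h \<bullet> (stable e \<bullet> word_prod ws)"
  by (simp_all add: word_prod_def)

lemma kap_word_simps [simp]:
  "kap_word [] = []"
  "kap_word ((h, e) # ws) = (kap h, e) # kap_word ws"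
  "kap_word (us @ ws) = kap_word us @ kap_word ws"
  "kap_word ws = [] \<longleftrightarrow> ws = []"
  "length (kap_word ws) = length ws"
  by (simp_all add: kap_word_def)

lemma word_prod_carrier [simp]:
  "fst ` set ws \<subseteq> bg_H \<Longrightarrow> word_prod ws \<in> carrier BG"
  by (induction ws) auto

lemma word_prod_append:
  assumes "fst ` set us \<subseteq> bg_H" "fst ` set ws \<subseteq> bg_H"
  shows "word_prod (us @ ws) = word_prod us \<bullet> word_prod ws"
  using assms by (induction us) (auto simp: BG.m_assoc)

lemma gact_word_prod:
  assumes "fst ` set ws \<subseteq> bg_H" "bg.red v"
  shows "gact (word_prod ws) v = bg.word_act (kap_word ws) v"
  using assms by (induction ws) (auto simp: gact_mult gact_bg_H gact_stable)

lemma reduced_Nil [simp]: "reduced []"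
  by (simp add: reduced_def)

lemma reduced_set: "reduced ws \<Longrightarrow> fst ` set ws \<subseteq> bg_H"
  by (simp add: reduced_def)

lemma reduced_carrier [simp]: "reduced ws \<Longrightarrow> word_prod ws \<in> carrier BG"
  by (simp add: reduced_set)

lemma reduced_Cons:
  "reduced ((h, e) # ws) \<longleftrightarrow> h \<in> bg_H \<and> reduced ws \<and>
    (case ws of [] \<Rightarrow> True | (h', e') # _ \<Rightarrow> \<not> (e' = (\<not> e) \<and> kap h' \<in> assoc_subgroup e'))"
  by (auto simp: reduced_def successively_Cons bg.no_pinch_def split: list.splits)

lemma reduced_append:
  "reduced (us @ ws) \<longleftrightarrow> reduced us \<and> reduced ws \<and>
    (us = [] \<or> ws = [] \<or> bg.no_pinch (last (kap_word us)) (hd (kap_word ws)))"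
  by (auto simp: reduced_def successively_append_iff)

lemma reduced_mult_bg_H:
  assumes "reduced ws" "ws \<noteq> []" "h \<in> bg_H"
  obtains ws' where "reduced ws'" "length ws' = length ws" "word_prod ws' = h \<bullet> word_prod ws"
proof -
  obtain h' e us where ws: "ws = (h', e) # us"
    using assms(2) by (cases ws) auto
  show ?thesis
    by (rule that[of "(h \<bullet> h', e) # us"])
      (use assms(1,3) in \<open>auto simp: ws reduced_Cons BG.m_assoc\<close>)
qed

definition has_reduced_form :: "bg_gen word set \<Rightarrow> bool" where
  "has_reduced_form g \<longleftrightarrow> (\<exists>ws h. reduced ws \<and> h \<in> bg_H \<and> g = word_prod ws \<bullet> h)"

lemma has_reduced_form_bg_H_mult:
  assumes "has_reduced_form g" "k \<in> bg_H"
  shows "has_reduced_form (k \<bullet> g)"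
proof -
  obtain ws h where ws: "reduced ws" "h \<in> bg_H" "g = word_prod ws \<bullet> h"
    using assms(1) by (auto simp: has_reduced_form_def)
  show ?thesis
  proof (cases "ws = []")
    case True
    then have "k \<bullet> g = word_prod [] \<bullet> (k \<bullet> h)" using ws assms by simp
    with ws(2) assms(2) show ?thesis
      by (metis has_reduced_form_def reduced_Nil bg_H_closed(4))
  next
    case False
    then obtain ws' where ws': "reduced ws'" "word_prod ws' = k \<bullet> word_prod ws"
      using reduced_mult_bg_H[OF ws(1) _ assms(2)] by blast
    then have "k \<bullet> g = word_prod ws' \<bullet> h"
      using ws assms by (simp add: BG.m_assoc)
    with ws(2) ws'(1) show ?thesis
      by (auto simp: has_reduced_form_def)
  qed
qed

text \<open>If the new letter creates a pinch, the pinch equals an element of \<open>H\<close>,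
  which is absorbed into the remaining word.\<close>

lemma has_reduced_form_stable_mult:
  assumes "has_reduced_form g"
  shows "has_reduced_form (stable e \<bullet> g)"
proof -
  obtain ws h where ws: "reduced ws" "h \<in> bg_H" "g = word_prod ws \<bullet> h"
    using assms by (auto simp: has_reduced_form_def)
  show ?thesis
  proof (cases "reduced ((\<one>\<^bsub>BG\<^esub>, e) # ws)")
    case True
    have "stable e \<bullet> g = word_prod ((\<one>\<^bsub>BG\<^esub>, e) # ws) \<bullet> h"
      using ws by (simp add: BG.m_assoc)
    with True ws(2) show ?thesis
      unfolding has_reduced_form_def by (intro exI conjI)
  next
    case False
    then obtain p us where "ws = p # us"
      using ws(1) by (cases ws) (simp_all add: reduced_Cons)
    with False ws(1) obtain h' where us: "ws = (h', \<not> e) # us" and h': "kap h' \<in> assoc_subgroup (\<not> e)"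
      by (cases p) (simp add: reduced_Cons)
    then have "h' \<in> bg_H" "reduced us" using ws(1) by (auto simp: reduced_Cons)
    then have "stable e \<bullet> g = BG.conjugate (stable (\<not> e)) h' \<bullet> (word_prod us \<bullet> h)"
      using ws(2) by (simp add: ws(3) us BG.conjugate_def BG.m_assoc)
    moreover have "has_reduced_form (word_prod us \<bullet> h)"
      using \<open>reduced us\<close> ws(2) by (auto simp: has_reduced_form_def)
    ultimately show ?thesis
      using conjugate_stable(1)[OF \<open>h' \<in> bg_H\<close> h'] by (simp add: has_reduced_form_bg_H_mult)
  qed
qed

lemma reduced_form:
  assumes "g \<in> carrier BG"
  obtains ws h where "reduced ws" "h \<in> bg_H" "g = word_prod ws \<bullet> h"
proof -
  have "has_reduced_form g"
    using assms
  proof (induction rule: BG_induct)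
    case one
    have "\<one>\<^bsub>BG\<^esub> = word_prod [] \<bullet> \<one>\<^bsub>BG\<^esub>" by simp
    then show ?case by (metis has_reduced_form_def reduced_Nil bg_H_closed(3))
  next
    case (step s g)
    then show ?case
      using has_reduced_form_stable_mult[of g True] has_reduced_form_stable_mult[of g False]
      by (auto simp: stable_def has_reduced_form_bg_H_mult)
  qed
  with that show ?thesis by (auto simp: has_reduced_form_def)
qed

section \<open>Length and elliptic elements\<close>

text \<open>By \<open>glen_reduced_form\<close>, the number of stable letters in any reduced form;
  defining it through the action makes it independent of the form.\<close>

definition glen :: "bg_gen word set \<Rightarrow> nat" where
  "glen g = depth (gact g (End 0))"

lemma gact_reduced_form:
  assumes "reduced ws" "h \<in> bg_H" "bg.red v"
  shows "gact (word_prod ws \<bullet> h) v = bg.word_act (kap_word ws) (bg.act (kap h) v)"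
  using assms by (simp add: gact_mult gact_word_prod gact_bg_H reduced_set)

lemma glen_reduced_form:
  assumes "reduced ws" "h \<in> bg_H"
  shows "glen (word_prod ws \<bullet> h) = length ws"
  using assms bg.Britton[of "kap_word ws" "kap h"]
  by (simp add: glen_def gact_reduced_form reduced_def)

lemma depth_gact_le:
  assumes "g \<in> carrier BG" "bg.red v"
  shows "depth (gact g v) \<le> glen g + depth v"
proof -
  obtain ws h where g: "reduced ws" "h \<in> bg_H" "g = word_prod ws \<bullet> h"
    using reduced_form[OF assms(1)] .
  show ?thesis
    using bg.depth_word_act_le[of "kap_word ws" "bg.act (kap h) v"] assms g
    by (simp add: glen_reduced_form gact_reduced_form)
qed

lemma glen_mult_le:
  assumes "g \<in> carrier BG" "h \<in> carrier BG"
  shows "glen (g \<bullet> h) \<le> glen g + glen h"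
  using depth_gact_le[of g "gact h (End 0)"] assms by (simp add: glen_def gact_mult)

lemma glen_one [simp]: "glen \<one>\<^bsub>BG\<^esub> = 0"
  by (simp add: glen_def)

lemma glen_pow_le:
  assumes "g \<in> carrier BG"
  shows "glen (g [^]\<^bsub>BG\<^esub> (k :: nat)) \<le> k * glen g"
proof (induction k)
  case (Suc k)
  then show ?case
    using glen_mult_le[of "g [^]\<^bsub>BG\<^esub> k" g] assms by simp
qed simp

lemma glen_cyclically_reduced_pow:
  assumes "reduced (ws @ ws)"
  shows "glen (word_prod ws [^]\<^bsub>BG\<^esub> (n :: nat)) = n * length ws"
proof -
  have ws: "reduced ws" using assms by (simp add: reduced_append)
  define us where "us n = concat (replicate n ws)" for n
  \<comment> \<open>The last conjunct ensures that prefixing another copy creates the same junction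
    as in \<open>ws @ ws\<close>.\<close>
  have "reduced (us n) \<and> word_prod (us n) = word_prod ws [^]\<^bsub>BG\<^esub> n \<and> length (us n) = n * length ws \<and>
      (us n = [] \<or> hd (kap_word (us n)) = hd (kap_word ws))" for n
  proof (induction n)
    case (Suc n)
    have eq: "us (Suc n) = ws @ us n" by (simp add: us_def)
    have "word_prod ws [^]\<^bsub>BG\<^esub> Suc n = word_prod ws \<bullet> word_prod ws [^]\<^bsub>BG\<^esub> n"
      using ws by (intro BG.nat_pow_Suc2) simp
    with Suc assms show ?case
      by (cases "ws = []") (auto simp: eq reduced_append word_prod_append reduced_set)
  qed (simp_all add: us_def)
  from this[of n] show ?thesis
    using glen_reduced_form[of "us n" "\<one>\<^bsub>BG\<^esub>"] ws by simp
qed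

lemma exponential_exceeds_linear: "\<exists>k. k * m + 1 < (2 :: nat) ^ k"
proof -
  have "j + 1 \<le> (2 :: nat) ^ j" for j
    by (induction j) auto
  \<comment> \<open>Squaring the bound \<open>j + 1 \<le> 2 ^ j\<close> at
    \<open>j = 2 * m + 1\<close> gives enough quadratic growth.\<close>
  from mult_mono[OF this[of "2 * m + 1"] this[of "2 * m + 1"]]
  have "(2 * m + 2) * (2 * m + 2) \<le> (2 :: nat) ^ (2 * (2 * m + 1))"
    by (simp only: mult_2[of "2 * m + 1"] power_add) simp
  then show ?thesis
    by (intro exI[of _ "2 * (2 * m + 1)"]) (simp add: algebra_simps)
qed

text \<open>
  A conjugate of minimal length is cyclically reduced, so the length of its powers grows linearly.
  But \<open>a\<^bsup>2^k\<^esup> = b\<^bsup>-k\<^esup> a b\<^bsup>k\<^esup>\<close> has length at most linear in \<open>k\<close>.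
\<close>

lemma conjugate_square_elliptic:
  assumes a: "a \<in> carrier BG" and b: "b \<in> carrier BG" and rel: "BG.conjugate b a = a \<bullet> a"
  obtains c where "c \<in> carrier BG" "BG.conjugate c a \<in> bg_H"
proof -
  define P where "P n \<longleftrightarrow> (\<exists>c ws h. c \<in> carrier BG \<and> reduced ws \<and> h \<in> bg_H \<and>
      BG.conjugate c a = word_prod ws \<bullet> h \<and> length ws = n)" for n
  obtain ws h where "reduced ws" "h \<in> bg_H" "a = word_prod ws \<bullet> h"
    using reduced_form[OF a] .
  then have "P (length ws)"
    unfolding P_def using a by (intro exI[of _ "\<one>\<^bsub>BG\<^esub>"]) auto
  then have "P (LEAST n. P n)" by (rule LeastI)
  then obtain c ws h where c: "c \<in> carrier BG" and ws: "reduced ws" and h: "h \<in> bg_H"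
    and ca: "BG.conjugate c a = word_prod ws \<bullet> h" and len: "length ws = (LEAST n. P n)"
    by (auto simp: P_def)
  have minimal: "length ws \<le> n" if "P n" for n
    unfolding len by (rule Least_le) (rule that)
  show ?thesis
  proof (cases "ws = []")
    case True
    with c ca h that show ?thesis by simp
  next
    case False
    obtain ws1 where ws1: "reduced ws1" "length ws1 = length ws" "word_prod ws1 = h \<bullet> word_prod ws"
      using reduced_mult_bg_H[OF ws False h] .
    define a1 where "a1 = word_prod ws1"
    \<comment> \<open>Conjugation by the inverse of \<open>h\<close> moves the trailing
      \<open>h\<close> to the front, where the first syllable absorbs it.\<close>
    define d where "d = c \<bullet> inv\<^bsub>BG\<^esub> h"
    have d: "d \<in> carrier BG" using c h by (simp add: d_def)
    have da: "BG.conjugate d a = a1"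
      using c h a ws by (simp add: d_def a1_def ws1(3) BG.conjugate_def[of "inv\<^bsub>BG\<^esub> h"]
          BG.m_assoc ca flip: BG.conjugate_conjugate)
    have "reduced (ws1 @ ws1)"
    proof (rule ccontr)
      assume "\<not> reduced (ws1 @ ws1)"
      obtain h1 e1 r where r: "ws1 = (h1, e1) # r"
        using ws1(2) False by (cases ws1) auto
      have pinch: "\<not> bg.no_pinch (last (kap_word ws1)) (kap h1, e1)"
        using \<open>\<not> reduced (ws1 @ ws1)\<close>[unfolded reduced_append] ws1(1) by (auto simp: r)
      \<comment> \<open>A single syllable cannot pinch with itself, as its exponent would be its own
        opposite.\<close>
      then have "r \<noteq> []" by (auto simp: r bg.no_pinch_def)
      then obtain mid l e where mid: "r = mid @ [(l, e)]"
        by (cases r rule: rev_cases) auto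
      have e: "e = (\<not> e1)" and kap: "kap h1 \<in> assoc_subgroup e1"
        using pinch by (auto simp: r mid bg.no_pinch_def)
      have h1: "h1 \<in> bg_H" and l: "l \<in> bg_H" and mid_red: "reduced mid"
        using ws1(1) by (auto simp: r mid reduced_append[of mid] reduced_Cons)
      \<comment> \<open>Rotating the first syllable behind \<open>z\<close> closes the pinch, which
        leaves two stable letters fewer and contradicts minimality.\<close>
      define z where "z = word_prod mid \<bullet> (l \<bullet> stable e)"
      have z: "z \<in> carrier BG" using l mid_red by (simp add: z_def)
      have "a1 = h1 \<bullet> stable e1 \<bullet> z"
        using h1 l mid_red reduced_set[OF mid_red]
        by (simp add: a1_def r mid z_def word_prod_append BG.m_assoc)
      then have "BG.conjugate (h1 \<bullet> stable e1) a1 = z \<bullet> (h1 \<bullet> stable e1)"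
        using h1 z by (simp add: BG.conjugate_mult_self)
      also have "\<dots> = word_prod mid \<bullet> (l \<bullet> BG.conjugate (stable e1) h1)"
        using h1 l mid_red by (simp add: z_def e BG.conjugate_def BG.m_assoc)
      finally have conj: "BG.conjugate (h1 \<bullet> stable e1) a1
          = word_prod mid \<bullet> (l \<bullet> BG.conjugate (stable e1) h1)" .
      have "BG.conjugate (d \<bullet> (h1 \<bullet> stable e1)) a
          = word_prod mid \<bullet> (l \<bullet> BG.conjugate (stable e1) h1)"
        using BG.conjugate_conjugate[of d "h1 \<bullet> stable e1" a] d h1 a by (simp add: da conj)
      moreover have "l \<bullet> BG.conjugate (stable e1) h1 \<in> bg_H"
        by (simp add: l conjugate_stable h1 kap)
      moreover have "d \<bullet> (h1 \<bullet> stable e1) \<in> carrier BG"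
        using d h1 by simp
      ultimately have "P (length mid)"
        unfolding P_def using mid_red by blast
      from minimal[OF this] show False
        using ws1(2) by (simp add: r mid)
    qed
    then have glen_pow: "glen (a1 [^]\<^bsub>BG\<^esub> n) = n * length ws1" for n :: nat
      unfolding a1_def by (rule glen_cyclically_reduced_pow)
    have a1: "a1 \<in> carrier BG" using ws1(1) by (simp add: a1_def)
    define b1 where "b1 = BG.conjugate d b"
    have b1: "b1 \<in> carrier BG" using d b by (simp add: b1_def)
    have "BG.conjugate b1 a1 = BG.conjugate d (a \<bullet> a)"
      using BG.conjugate_distrib[OF d b a] by (simp add: b1_def da rel)
    also have "\<dots> = a1 [^]\<^bsub>BG\<^esub> (2 :: nat)"
      using a1 by (simp add: BG.conjugate_mult d a da numeral_2_eq_2)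
    finally have rel1: "BG.conjugate b1 a1 = a1 [^]\<^bsub>BG\<^esub> (2 :: nat)" .
    have pow: "BG.conjugate (b1 [^]\<^bsub>BG\<^esub> k) a1 = a1 [^]\<^bsub>BG\<^esub> ((2 :: nat) ^ k)" for k :: nat
    proof (induction k)
      case (Suc k)
      have "BG.conjugate (b1 [^]\<^bsub>BG\<^esub> Suc k) a1 = BG.conjugate b1 (BG.conjugate (b1 [^]\<^bsub>BG\<^esub> k) a1)"
        using a1 b1 by (simp add: BG.conjugate_conjugate)
      also have "\<dots> = a1 [^]\<^bsub>BG\<^esub> ((2 :: nat) ^ Suc k)"
        using a1 b1 by (simp add: Suc BG.conjugate_pow rel1 BG.nat_pow_pow)
      finally show ?case .
    qed (use a1 in simp)
    define m where "m = glen (inv\<^bsub>BG\<^esub> b1) + glen b1"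
    have bound: "2 ^ k * length ws1 \<le> k * m + length ws1" for k :: nat
    proof -
      have "2 ^ k * length ws1 = glen (a1 [^]\<^bsub>BG\<^esub> ((2 :: nat) ^ k))"
        by (simp add: glen_pow)
      also have "a1 [^]\<^bsub>BG\<^esub> ((2 :: nat) ^ k) = (inv\<^bsub>BG\<^esub> b1) [^]\<^bsub>BG\<^esub> k \<bullet> a1 \<bullet> b1 [^]\<^bsub>BG\<^esub> k"
        using pow[of k] b1 by (simp add: BG.conjugate_def BG.nat_pow_inv)
      also have "glen \<dots> \<le> glen ((inv\<^bsub>BG\<^esub> b1) [^]\<^bsub>BG\<^esub> k) + glen a1 + glen (b1 [^]\<^bsub>BG\<^esub> k)"
        using a1 b1 glen_mult_le[of "(inv\<^bsub>BG\<^esub> b1) [^]\<^bsub>BG\<^esub> k \<bullet> a1" "b1 [^]\<^bsub>BG\<^esub> k"]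
          glen_mult_le[of "(inv\<^bsub>BG\<^esub> b1) [^]\<^bsub>BG\<^esub> k" a1] by simp
      also have "\<dots> \<le> k * m + length ws1"
        using glen_pow_le[of "inv\<^bsub>BG\<^esub> b1" k] glen_pow_le[of b1 k] glen_pow[of 1] a1 b1
        by (simp add: m_def distrib_left)
      finally show ?thesis .
    qed
    obtain k where k: "k * m + 1 < (2 :: nat) ^ k"
      using exponential_exceeds_linear by blast
    have pos: "1 \<le> length ws1" using ws1(2) False by (simp add: Suc_le_eq)
    have "(k * m + 1) * length ws1 < 2 ^ k * length ws1"
      using k pos by (intro mult_strict_right_mono) auto
    also have "\<dots> \<le> k * m + length ws1" by (rule bound)
    finally have "k * m * length ws1 + length ws1 < k * m + length ws1"
      by (simp only: distrib_right mult_1)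
    moreover have "k * m * 1 \<le> k * m * length ws1"
      by (rule mult_le_mono2) (rule pos)
    ultimately have False by linarith
    then show ?thesis ..
  qed
qed

section \<open>Conjugation of elliptic elements\<close>

lemma gact_top:
  assumes "reduced ((h, e) # ws)" "k \<in> bg_H"
  obtains v where "gact (word_prod ((h, e) # ws) \<bullet> k) (End 0) = Edge (bg.rep e (kap h)) e v"
proof -
  have "successively bg.no_pinch (kap_word ((h, e) # ws))"
    using assms(1) by (simp only: reduced_def)
  from bg.Britton[OF this, of "kap k"] obtain v
    where "bg.word_act (kap_word ((h, e) # ws)) (End (kap k)) = Edge (bg.rep e (kap h)) e v"
    by auto
  with gact_reduced_form[OF assms, of "End 0"] that show ?thesis by simp
qed

text \<open>Compare the first letters of the normal forms of \<open>a c\<close> and of \<open>c (c\<inverse> a c)\<close>.\<close>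

lemma conjugate_reduced_form_into_bg_H:
  assumes "a \<in> bg_H" and red: "reduced ((h, e) # ws)" and "k \<in> bg_H"
    and conj: "BG.conjugate (word_prod ((h, e) # ws) \<bullet> k) a \<in> bg_H"
  shows "kap (BG.conjugate h a) \<in> assoc_subgroup e"
proof -
  define w where "w = word_prod ((h, e) # ws)"
  define z where "z = BG.conjugate (w \<bullet> k) a"
  have h: "h \<in> bg_H" and ws: "word_prod ws \<in> carrier BG"
    using red by (simp_all add: reduced_Cons)
  have w: "w \<in> carrier BG"
    using h ws by (simp add: w_def)
  have z: "z \<in> bg_H"
    using conj by (simp add: z_def w_def)
  \<comment> \<open>Reducedness restricts only the syllables after the first by subgroup membership,
    so \<open>a\<close> can be absorbed into \<open>h\<close>.\<close>
  have red': "reduced ((a \<bullet> h, e) # ws)"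
    using red assms(1) by (simp add: reduced_Cons)
  have "word_prod ((a \<bullet> h, e) # ws) \<bullet> k = a \<bullet> (w \<bullet> k)"
    using assms(1,3) h ws by (simp add: w_def BG.m_assoc)
  also have "\<dots> = w \<bullet> (k \<bullet> z)"
    using assms(1,3) w by (simp add: z_def BG.conjugate_def BG.m_assoc BG.inv_mult_group BG.inv_cancel)
  finally have eq: "word_prod ((a \<bullet> h, e) # ws) \<bullet> k = word_prod ((h, e) # ws) \<bullet> (k \<bullet> z)"
    by (simp only: w_def)
  obtain v where "gact (word_prod ((h, e) # ws) \<bullet> (k \<bullet> z)) (End 0) = Edge (bg.rep e (kap h)) e v"
    using gact_top[OF red, of "k \<bullet> z"] assms(3) z by auto
  moreover obtain v' where
    "gact (word_prod ((a \<bullet> h, e) # ws) \<bullet> k) (End 0) = Edge (bg.rep e (kap (a \<bullet> h))) e v'"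
    using gact_top[OF red' assms(3)] .
  ultimately have "bg.rep e (kap h) = bg.rep e (kap (a \<bullet> h))"
    unfolding eq by simp
  then have "- kap h + kap (a \<bullet> h) \<in> assoc_subgroup e"
    by (simp only: bg.rep_eq_iff)
  then show ?thesis
    using assms(1) h by (simp add: kap_conjugate add.assoc)
qed

lemma power_int_2_eq_iff: "(2 :: rat) powi m = 2 powi n \<longleftrightarrow> m = n"
  using power_int_strict_increasing[of m n "2 :: rat"] power_int_strict_increasing[of n m "2 :: rat"]
  by (cases m n rule: linorder_cases) auto

lemma expo_kap_conjugate [simp]:
  "g \<in> bg_H \<Longrightarrow> h \<in> bg_H \<Longrightarrow> expo (kap (BG.conjugate g h)) = expo (kap h)"
  by (simp add: kap_conjugate)

text \<open>Exponent 0 means membership in \<open>N\<close>. A first stable letter of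
  \<open>c\<close> must be \<open>t\<close> and turns the element into \<open>y^m\<close> with
  \<open>m \<noteq> 0\<close>. If no letter follows, the exponent stays nonzero; if one follows, it
  must be the inverse of \<open>t\<close> with a power of \<open>y\<close> in between, a
  pinch.\<close>

lemma conjugate_x_axis_imp_bg_H:
  assumes c: "c \<in> carrier BG" and a: "a \<in> bg_H" "a \<noteq> \<one>\<^bsub>BG\<^esub>" "expo (kap a) = 0"
    and ca: "BG.conjugate c a \<in> bg_H" "expo (kap (BG.conjugate c a)) = 0"
  shows "c \<in> bg_H"
proof -
  obtain ws k where ws: "reduced ws" and k: "k \<in> bg_H" and c_eq: "c = word_prod ws \<bullet> k"
    using reduced_form[OF c] .
  show ?thesis
  proof (cases ws)
    case Nil
    with c_eq k show ?thesis by simp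
  next
    case (Cons p us)
    obtain h e where p: "p = (h, e)" by (cases p)
    have red: "reduced ((h, e) # us)" using ws by (simp add: Cons p)
    then have h: "h \<in> bg_H" and us: "reduced us" by (simp_all add: reduced_Cons)
    have kap_ha: "kap (BG.conjugate h a) \<in> assoc_subgroup e"
      using conjugate_reduced_form_into_bg_H[OF a(1) red k] ca(1) by (simp only: c_eq Cons p)
    have "expo (kap (BG.conjugate h a)) = 0"
      using h a by simp
    moreover have "kap (BG.conjugate h a) \<noteq> 0"
      using kap_eq_0[of "BG.conjugate h a"] h a by auto
    ultimately obtain m :: int where e: e and m: "m \<noteq> 0" "kap (BG.conjugate h a) = Aff (of_int m) 0"
      using kap_ha by (cases e) (auto simp: assoc_subgroup_def zero_aff_def)
    define a1 where "a1 = BG.conjugate (stable e) (BG.conjugate h a)"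
    define c1 where "c1 = word_prod us \<bullet> k"
    have a1: "a1 \<in> bg_H" and kap_a1: "kap a1 = Aff 0 m"
      using conjugate_stable[OF _ kap_ha] h a e m by (simp_all add: a1_def)
    have c1_carrier: "c1 \<in> carrier BG"
      using us k by (simp add: c1_def)
    have "c = h \<bullet> stable e \<bullet> c1"
      using h us k by (simp add: c_eq Cons p c1_def BG.m_assoc)
    then have c1: "BG.conjugate c1 a1 = BG.conjugate c a"
      using h a(1) c1_carrier by (simp add: a1_def BG.conjugate_conjugate BG.m_assoc)
    show ?thesis
    proof (cases us)
      case Nil
      then have "c1 = k" using k by (simp add: c1_def)
      then have "expo (kap a1) = 0" using c1 ca k a1 by (metis expo_kap_conjugate)
      with m kap_a1 show ?thesis by simp
    next
      case (Cons p1 vs)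
      obtain h1 e1 where p1: "p1 = (h1, e1)" by (cases p1)
      have red1: "reduced ((h1, e1) # vs)" using us by (simp add: Cons p1)
      then have h1: "h1 \<in> bg_H" by (simp add: reduced_Cons)
      have kap_h1: "kap (BG.conjugate h1 a1) \<in> assoc_subgroup e1"
        using conjugate_reduced_form_into_bg_H[OF a1 red1 k] ca(1)
        by (simp only: c1_def Cons p1 flip: c1)
      moreover have "expo (kap (BG.conjugate h1 a1)) = m"
        using h1 a1 kap_a1 by simp
      ultimately obtain m1 where e1: "\<not> e1" "kap (BG.conjugate h1 a1) = Aff 0 m1"
        using m(1) by (cases e1) (auto simp: assoc_subgroup_def)
      obtain q n where qn: "kap h1 = Aff q n" by (cases "kap h1")
      \<comment> \<open>The conjugate fixes 0, so the map of \<open>y^m\<close> fixes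
        \<open>q\<close>; for \<open>m \<noteq> 0\<close> its only fixed point is 0.\<close>
      have "q = 0 \<or> (2 :: rat) powi m = 1"
        using e1(2) h1 a1 kap_a1
        by (auto simp: kap_conjugate qn power_int_diff power_int_add power_int_minus field_simps)
      then have "q = 0"
        using m(1) power_int_2_eq_iff[of m 0] by simp
      then have "kap h1 \<in> assoc_subgroup e1"
        using e1(1) qn by (simp add: assoc_subgroup_def)
      moreover have "reduced ((h, e) # (h1, e1) # vs)"
        using red by (simp add: Cons p1)
      ultimately show ?thesis
        using e e1(1) by (simp add: reduced_Cons[of h])
    qed
  qed
qed

text \<open>If the exponent in \<open>H\<close> is nonzero, then \<open>b1\<close> lies outside
  \<open>H\<close>, since conjugation in \<open>H\<close> preserves exponents while squaring doubles
  them. The first stable letter of \<open>b1\<close> then takes a conjugate of \<open>a1\<close>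
  from the powers of \<open>y\<close> to those of \<open>x\<close>.\<close>

lemma conjugate_square_normalize:
  assumes a: "a \<in> carrier BG" and b: "b \<in> carrier BG" and rel: "BG.conjugate b a = a \<bullet> a"
  obtains c where "c \<in> carrier BG" "BG.conjugate c a \<in> bg_H" "expo (kap (BG.conjugate c a)) = 0"
proof -
  obtain c where c: "c \<in> carrier BG" and ca: "BG.conjugate c a \<in> bg_H"
    using conjugate_square_elliptic[OF assms] .
  define a1 where "a1 = BG.conjugate c a"
  define b1 where "b1 = BG.conjugate c b"
  have a1: "a1 \<in> bg_H" and b1: "b1 \<in> carrier BG"
    using ca b c by (simp_all add: a1_def b1_def)
  have rel1: "BG.conjugate b1 a1 = a1 \<bullet> a1"
    using BG.conjugate_distrib[OF c b a] c a by (simp add: a1_def b1_def rel BG.conjugate_mult)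
  show ?thesis
  proof (cases "expo (kap a1) = 0")
    case True
    with c ca that show ?thesis by (simp add: a1_def)
  next
    case False
    obtain ws k where ws: "reduced ws" and k: "k \<in> bg_H" and b1_eq: "b1 = word_prod ws \<bullet> k"
      using reduced_form[OF b1] .
    have "ws \<noteq> []"
    proof
      assume "ws = []"
      then have "b1 \<in> bg_H" using b1_eq k by simp
      from expo_kap_conjugate[OF this a1] False a1 show False
        by (simp add: rel1)
    qed
    then obtain h e us where us: "ws = (h, e) # us" by (cases ws) auto
    have red: "reduced ((h, e) # us)" using ws by (simp add: us)
    then have h: "h \<in> bg_H" by (simp add: reduced_Cons)
    have kap_h: "kap (BG.conjugate h a1) \<in> assoc_subgroup e"
      using conjugate_reduced_form_into_bg_H[OF a1 red k] rel1 a1 by (simp add: b1_eq us)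
    moreover have "expo (kap (BG.conjugate h a1)) \<noteq> 0"
      using h a1 False by simp
    ultimately have "\<not> e" by (cases e) (auto simp: assoc_subgroup_def)
    define d where "d = c \<bullet> (h \<bullet> stable e)"
    have d: "d \<in> carrier BG" using c h by (simp add: d_def)
    have da: "BG.conjugate d a = BG.conjugate (stable e) (BG.conjugate h a1)"
      using c h a by (simp add: d_def a1_def BG.conjugate_conjugate BG.m_assoc)
    have "BG.conjugate d a \<in> bg_H" "expo (kap (BG.conjugate d a)) = 0"
      using conjugate_stable[OF _ kap_h] h a1 \<open>\<not> e\<close>
      by (cases "kap (BG.conjugate h a1)"; simp add: da)+
    with d that show ?thesis by blast
  qed
qed

lemma conjugate_to_generators:
  assumes a: "a \<in> carrier BG" "a \<noteq> \<one>\<^bsub>BG\<^esub>" and b: "b \<in> carrier BG" and s: "s \<in> carrier BG"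
    and rel: "BG.conjugate b a = a \<bullet> a" "BG.conjugate s a = b"
  obtains c where "c \<in> carrier BG" "BG.conjugate c a = bg_x" "BG.conjugate c b = bg_y"
proof -
  obtain c where c: "c \<in> carrier BG" and ca: "BG.conjugate c a \<in> bg_H"
    and expo: "expo (kap (BG.conjugate c a)) = 0"
    using conjugate_square_normalize[OF a(1) b rel(1)] .
  define a1 where "a1 = BG.conjugate c a"
  define b1 where "b1 = BG.conjugate c b"
  have a1: "a1 \<in> bg_H" "a1 \<noteq> \<one>\<^bsub>BG\<^esub>" "expo (kap a1) = 0"
    using ca expo c a by (simp_all add: a1_def)
  have b1: "b1 \<in> carrier BG"
    using b c by (simp add: b1_def)
  have rel1: "BG.conjugate b1 a1 = a1 \<bullet> a1"
    using BG.conjugate_distrib[OF c b a(1)] c a(1)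
    by (simp add: a1_def b1_def rel(1) BG.conjugate_mult)
  have b1_H: "b1 \<in> bg_H"
    using conjugate_x_axis_imp_bg_H[OF b1 a1] a1 by (simp add: rel1)
  obtain q where q: "kap a1 = Aff q 0"
    using a1(3) by (cases "kap a1") auto
  have q0: "q \<noteq> 0"
    using kap_eq_0[OF a1(1)] a1(2) by (auto simp: q zero_aff_def)
  \<comment> \<open>Conjugation by \<open>b1\<close> multiplies shifts of translations by
    \<open>2^n\<close>, and the relation demands the factor 2.\<close>
  obtain r n where "kap b1 = Aff r n" by (cases "kap b1")
  moreover from this have "2 powi n * q = 2 * q"
    using arg_cong[OF rel1, of kap] b1_H a1(1) by (simp add: kap_conjugate q field_simps)
  then have "n = 1"
    using power_int_2_eq_iff[of n 1] q0 by simp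
  ultimately have r: "kap b1 = Aff r 1" by simp
  \<comment> \<open>This is the translation by \<open>2 * r\<close>, the fixed point of the map of
    \<open>b1\<close>. Conjugating by it moves the fixed point to 0 and leaves the translation
    \<open>a1\<close> unchanged.\<close>
  define d where "d = (b1 \<bullet> inv\<^bsub>BG\<^esub> bg_y) \<bullet> (b1 \<bullet> inv\<^bsub>BG\<^esub> bg_y)"
  have d: "d \<in> bg_H" and kap_d: "kap d = Aff (2 * r) 0"
    using b1_H by (simp_all add: d_def r)
  have da: "BG.conjugate d a1 = a1"
    using d a1(1) by (intro kap_inject) (simp_all add: kap_conjugate kap_d q)
  have db: "BG.conjugate d b1 = bg_y"
    using d b1_H by (intro kap_inject) (simp_all add: kap_conjugate kap_d r power_int_minus)
  define s1 where "s1 = BG.conjugate d (BG.conjugate c s)"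
  have s1: "s1 \<in> carrier BG"
    using c d s by (simp add: s1_def)
  have "BG.conjugate s1 a1 = BG.conjugate s1 (BG.conjugate d a1)"
    by (simp add: da)
  also have "\<dots> = bg_y"
    using BG.conjugate_distrib[of d "BG.conjugate c s" a1] BG.conjugate_distrib[OF c s a(1)]
      c d s a1(1) db by (simp add: s1_def a1_def b1_def rel(2))
  finally have s1a: "BG.conjugate s1 a1 = bg_y" .
  \<comment> \<open>As \<open>y\<close> is the conjugate of \<open>x\<close> by \<open>t\<close>,
    this element takes \<open>a1\<close> to \<open>x\<close>, both in \<open>N\<close>, and so lies
    in \<open>H\<close>.\<close>
  define f where "f = s1 \<bullet> inv\<^bsub>BG\<^esub> bg_t"
  have f: "f \<in> carrier BG" using s1 by (simp add: f_def)
  have fa: "BG.conjugate f a1 = bg_x"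
    using BG.conjugate_conjugate[of s1 "inv\<^bsub>BG\<^esub> bg_t" a1] s1 a1(1)
    by (simp add: f_def s1a flip: conjugate_t_x)
  have f_H: "f \<in> bg_H"
    using conjugate_x_axis_imp_bg_H[OF f a1] by (simp add: fa)
  obtain u n where un: "kap f = Aff u n" by (cases "kap f")
  have qn: "2 powi n * q = 1"
    using arg_cong[OF fa, of kap] f_H a1(1) by (simp add: kap_conjugate q un field_simps)
  \<comment> \<open>Only the exponent of \<open>f\<close> matters for its effect on
    \<open>a1\<close>; the same power of \<open>y\<close> does this while fixing
    \<open>y\<close>.\<close>
  define g where "g = bg_y [^]\<^bsub>BG\<^esub> n"
  have g: "g \<in> bg_H" by (simp add: g_def)
  have ga: "BG.conjugate g a1 = bg_x"
    using g a1(1) qn by (intro kap_inject) (simp_all add: kap_conjugate q g_def kap_int_pow)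
  have gb: "BG.conjugate g bg_y = bg_y"
    using g by (intro kap_inject) (simp_all add: kap_conjugate g_def kap_int_pow)
  have "BG.conjugate (c \<bullet> (d \<bullet> g)) a = bg_x"
    using BG.conjugate_conjugate[of c "d \<bullet> g" a] BG.conjugate_conjugate[of d g a1]
      c d g a(1) a1(1) da ga by (simp add: a1_def)
  moreover have "BG.conjugate (c \<bullet> (d \<bullet> g)) b = bg_y"
    using BG.conjugate_conjugate[of c "d \<bullet> g" b] BG.conjugate_conjugate[of d g b1]
      c d g b b1 db gb by (simp add: b1_def)
  ultimately show ?thesis
    using c d g by (intro that[of "c \<bullet> (d \<bullet> g)"]) simp_all
qed

section \<open>Endomorphisms\<close>

lemma BG_hom_eq_id:
  assumes "E \<in> hom BG BG" "E bg_x = bg_x" "E bg_y = bg_y" "E bg_t = bg_t" "a \<in> carrier BG"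
  shows "E a = a"
proof -
  interpret E: group_hom BG BG E
    by unfold_locales (rule assms)
  show ?thesis
    using assms(5)
  proof (induction rule: BG_induct)
    case (step s g)
    then have "s \<in> carrier BG" "E s = s" using assms by auto
    with step show ?case by simp
  qed simp
qed

lemma BG_hom_eq_id_on_bg_H:
  assumes "E \<in> hom BG BG" "E bg_x = bg_x" "E bg_y = bg_y" "h \<in> bg_H"
  shows "E h = h"
proof -
  interpret E: group_hom BG BG E
    by unfold_locales (rule assms)
  show ?thesis
    using assms(4) unfolding bg_H_def
  proof (induction rule: generate.induct)
    case (eng g h)
    then have "g \<in> carrier BG" "h \<in> carrier BG" by (auto simp flip: bg_H_def)
    with eng show ?case by simp
  qed (use assms in auto)
qed

theorem proposition3p5:
  fixes F :: "bg_gen word set \<Rightarrow> bg_gen word set"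
  assumes "F \<in> hom BG BG"
  shows
    "(F bg_x = \<one>\<^bsub>BG\<^esub> \<longrightarrow> F bg_y = \<one>\<^bsub>BG\<^esub>) \<and>
     (\<forall>w\<in>carrier BG. \<exists>E\<in>hom BG BG. E bg_x = \<one>\<^bsub>BG\<^esub> \<and> E bg_y = \<one>\<^bsub>BG\<^esub> \<and> E bg_t = w) \<and>
     (F bg_x \<noteq> \<one>\<^bsub>BG\<^esub> \<longrightarrow>
        F \<in> iso BG BG \<and>
        (\<exists>A\<in>inner_automorphisms BG. \<exists>g\<in>centralizer_in BG bg_H bg_x.
           (A \<circ> F) bg_x = bg_x \<and> (A \<circ> F) bg_y = bg_y \<and> (A \<circ> F) bg_t = g \<otimes>\<^bsub>BG\<^esub> bg_t))"
proof (intro conjI impI ballI)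
  interpret F: group_hom BG BG F
    by unfold_locales (rule assms)
  have relF: "F (BG.conjugate u v) = BG.conjugate (F u) (F v)"
    if "u \<in> carrier BG" "v \<in> carrier BG" for u v
    using that by (simp add: BG.conjugate_def)
  show "F bg_y = \<one>\<^bsub>BG\<^esub>" if "F bg_x = \<one>\<^bsub>BG\<^esub>"
    using relF[of bg_t bg_x] that by (simp add: conjugate_t_x)
  show "\<exists>E\<in>hom BG BG. E bg_x = \<one>\<^bsub>BG\<^esub> \<and> E bg_y = \<one>\<^bsub>BG\<^esub> \<and> E bg_t = w"
    if w: "w \<in> carrier BG" for w
    by (rule BG.BG_hom[of "\<one>\<^bsub>BG\<^esub>" "\<one>\<^bsub>BG\<^esub>" w]) (use w in auto)
  assume nontrivial: "F bg_x \<noteq> \<one>\<^bsub>BG\<^esub>"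
  obtain c where c: "c \<in> carrier BG"
    and cx: "BG.conjugate c (F bg_x) = bg_x" and cy: "BG.conjugate c (F bg_y) = bg_y"
  proof (rule conjugate_to_generators[of "F bg_x" "F bg_y" "F bg_t"])
    show "BG.conjugate (F bg_y) (F bg_x) = F bg_x \<bullet> F bg_x"
      using relF[of bg_y bg_x] by (simp add: conjugate_y_x)
    show "BG.conjugate (F bg_t) (F bg_x) = F bg_y"
      using relF[of bg_t bg_x] by (simp add: conjugate_t_x)
  qed (use nontrivial in auto)
  define K where "K a = BG.conjugate c (F a)" for a
  have K_hom: "K \<in> hom BG BG"
    by (auto simp: hom_def K_def c BG.conjugate_mult)
  interpret K: group_hom BG BG K
    by unfold_locales (rule K_hom)
  have K_xy: "K bg_x = bg_x" "K bg_y = bg_y"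
    by (simp_all add: K_def cx cy)
  define g where "g = K bg_t \<bullet> inv\<^bsub>BG\<^esub> bg_t"
  have g: "g \<in> carrier BG" and Kt: "K bg_t = g \<bullet> bg_t"
    by (simp_all add: g_def BG.m_assoc)
  have "BG.conjugate (K bg_t) bg_x = K (BG.conjugate bg_t bg_x)"
    by (simp add: BG.conjugate_def K_xy)
  then have "BG.conjugate (K bg_t) bg_x = bg_y"
    by (simp add: conjugate_t_x K_xy)
  then have gx: "BG.conjugate g bg_x = bg_x"
    using BG.conjugate_conjugate[of "K bg_t" "inv\<^bsub>BG\<^esub> bg_t" bg_x]
    by (simp add: g_def flip: conjugate_t_x)
  \<comment> \<open>Otherwise \<open>F\<close> would send \<open>x\<close> to the identity.\<close>
  have "bg_x \<noteq> \<one>\<^bsub>BG\<^esub>"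
    using nontrivial F.hom_one by metis
  then have g_H: "g \<in> bg_H"
    using conjugate_x_axis_imp_bg_H[OF g, of bg_x] gx by simp
  have "g \<bullet> BG.conjugate g bg_x = bg_x \<bullet> g"
    using g by (simp add: BG.conjugate_def BG.m_assoc BG.inv_cancel)
  then have g_cent: "g \<in> centralizer_in BG bg_H bg_x"
    using g_H by (simp add: centralizer_in_def gx)
  define A where "A = (\<lambda>a\<in>carrier BG. inv\<^bsub>BG\<^esub> c \<bullet> a \<bullet> c)"
  have "A \<in> inner_automorphisms BG"
    using c by (auto simp: inner_automorphisms_def A_def)
  moreover have "(A \<circ> F) a = K a" if "a \<in> carrier BG" for a
    using that by (simp add: A_def K_def BG.conjugate_def)
  ultimately show "\<exists>A\<in>inner_automorphisms BG. \<exists>g\<in>centralizer_in BG bg_H bg_x.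
      (A \<circ> F) bg_x = bg_x \<and> (A \<circ> F) bg_y = bg_y \<and> (A \<circ> F) bg_t = g \<otimes>\<^bsub>BG\<^esub> bg_t"
    using g_cent by (intro bexI[of _ A] bexI[of _ g]) (simp_all add: K_xy Kt)
  have "BG.conjugate (inv\<^bsub>BG\<^esub> g \<bullet> bg_t) bg_x = BG.conjugate bg_t (BG.conjugate (inv\<^bsub>BG\<^esub> g) bg_x)"
    using g by (simp add: BG.conjugate_conjugate)
  also have "BG.conjugate (inv\<^bsub>BG\<^esub> g) bg_x = bg_x"
    using BG.conjugate_conjugate_inv(1)[OF g, of bg_x] by (simp add: gx)
  finally have gtx: "BG.conjugate (inv\<^bsub>BG\<^esub> g \<bullet> bg_t) bg_x = bg_y"
    by (simp add: conjugate_t_x)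
  \<comment> \<open>The inverse of \<open>K\<close>: since \<open>K\<close> fixes \<open>g\<close>
    and sends \<open>t\<close> to \<open>g t\<close>, the preimage of \<open>t\<close> must be
    \<open>t\<close> multiplied on the left by the inverse of \<open>g\<close>.\<close>
  obtain E where E_hom: "E \<in> hom BG BG"
    and E: "E bg_x = bg_x" "E bg_y = bg_y" "E bg_t = inv\<^bsub>BG\<^esub> g \<bullet> bg_t"
    by (rule BG.BG_hom[of bg_x bg_y "inv\<^bsub>BG\<^esub> g \<bullet> bg_t"])
      (use g gtx conjugate_y_x in \<open>simp_all add: BG.conjugate_def\<close>)
  interpret E: group_hom BG BG E
    by unfold_locales (rule E_hom)
  have Eg: "E g = g"
    by (rule BG_hom_eq_id_on_bg_H[OF E_hom E(1,2) g_H])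
  have Kg: "K g = g"
    by (rule BG_hom_eq_id_on_bg_H[OF K_hom K_xy g_H])
  have EK: "E (K a) = a" if "a \<in> carrier BG" for a
  proof (rule BG_hom_eq_id[of "\<lambda>a. E (K a)"])
    show "(\<lambda>a. E (K a)) \<in> hom BG BG"
      by (auto simp: hom_def)
    show "E (K bg_t) = bg_t"
      using g by (simp add: Kt Eg E BG.inv_cancel)
  qed (simp_all add: K_xy E that)
  have KE: "K (E a) = a" if "a \<in> carrier BG" for a
  proof (rule BG_hom_eq_id[of "\<lambda>a. K (E a)"])
    show "(\<lambda>a. K (E a)) \<in> hom BG BG"
      by (auto simp: hom_def)
    show "K (E bg_t) = bg_t"
      using g by (simp add: Kt Kg E BG.inv_cancel)
  qed (simp_all add: K_xy E that)
  have "bij_betw F (carrier BG) (carrier BG)"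
  \<comment> \<open>\<open>F\<close> is \<open>K\<close> followed by conjugation with the inverse of
    \<open>c\<close>, so its inverse is conjugation by \<open>c\<close> followed by
    \<open>E\<close>.\<close>
  proof (rule bij_betw_byWitness[where f' = "\<lambda>a. E (BG.conjugate c a)"])
    show "\<forall>a\<in>carrier BG. E (BG.conjugate c (F a)) = a"
      using EK by (simp add: K_def)
    show "\<forall>a\<in>carrier BG. F (E (BG.conjugate c a)) = a"
    proof
      fix a assume a: "a \<in> carrier BG"
      have "F (E (BG.conjugate c a)) = BG.conjugate (inv\<^bsub>BG\<^esub> c) (K (E (BG.conjugate c a)))"
        using a c by (simp add: K_def)
      also have "\<dots> = a"
        using a c by (simp add: KE)
      finally show "F (E (BG.conjugate c a)) = a" .
    qed
  qed (use c in auto)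
  with assms show "F \<in> iso BG BG"
    by (simp add: iso_def)
qed

end
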